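(* Let $G=(V,E)$ be a graph with $|V|\geq 5$ such that: (i) $G$ is $8$-edge-connected, (ii) $G-\{u\}$ is $6$-edge-connected for all $u\in V$, (iii) $G-\{u,v\}$ is $4$-edge-connected for all $u,v\in V$, and (iv) $G-\{u,v,w\}$ is $2$-edge-connected for all $u,v,w\in V$. Then $G$ is rigid in the cylindrical normed space $\mathbb{R}^2\oplus_\infty\mathbb{R}$. In particular, every $8$-connected graph is rigid in $\mathbb{R}^2\oplus_\infty\mathbb{R}$.
   Context: All graphs are finite, simple and undirected. For a set $U$ of vertices, $G-U$ is the graph obtained by deleting the vertices in $U$ (and incident edges). $\mathbb{R}^2$ has the Euclidean norm $\|\cdot\|_2$ and $\mathbb{R}^2\oplus_\infty\mathbb{R}$ is the direct sum with norm $\|(x,y)\|=\max\{\|x\|_2,|y|\}$. Let $Y$ be a finite dimensional real normed space. A framework in $Y$ is a pair $(G,p)$ with $G=(V,E)$ a graph and $p=(p_v)_{v\in V}\in Y^V$ (a placement of $G$) with $p_v\neq p_w$ for every $vw\in E$. The rigidity map is $f_G:Y^V\to\mathbb{R}^E$, $(x_v)_{v}\mapsto(\|x_v-x_w\|_Y)_{vw\in E}$. The framework is well-positioned if $f_G$ is differentiable at $p$. A rigid motion of $Y$ is a family of continuous paths $\alpha_x:[-1,1]\to Y$ ($x\in Y$) such that $\alpha_x(0)=x$, $\alpha_x$ is differentiable at $0$, and $\|\alpha_x(t)-\alpha_y(t)\|_Y=\|x-y\|_Y$ for all $x,y\in Y$, $t\in[-1,1]$. Maps $\eta:Y\to Y$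 of the form $\eta(x)=\alpha_x'(0)$ are infinitesimal rigid motions; they form a linear space $\mathcal{T}(Y)$. Put $\mathcal{T}(G,p)=\{(\eta(p_v))_{v\in V}:\eta\in\mathcal{T}(Y)\}\subseteq\ker df_G(p)$. A well-positioned framework $(G,p)$ is infinitesimally rigid if $\ker df_G(p)=\mathcal{T}(G,p)$. A graph $G$ is rigid in $Y$ if there is a well-positioned placement $p\in Y^V$ such that $(G,p)$ is infinitesimally rigid. *)

theory Defs
  imports "HOL-Analysis.Analysis"
begin

section \<open>Graphs and connectivity\<close>

type_synonym 'v graph = "'v set \<times> 'v set set"

abbreviation verts :: "'v graph \<Rightarrow> 'v set" where "verts \<equiv> fst"
abbreviation edges :: "'v graph \<Rightarrow> 'v set set" where "edges \<equiv> snd"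

definition simple_graph :: "'v graph \<Rightarrow> bool" where
  "simple_graph G \<longleftrightarrow> finite (verts G) \<and> (\<forall>e\<in>edges G. e \<subseteq> verts G \<and> card e = 2)"

definition delete_verts :: "'v graph \<Rightarrow> 'v set \<Rightarrow> 'v graph" where
  "delete_verts G U = (verts G - U, {e \<in> edges G. e \<inter> U = {}})"

definition delete_edges :: "'v graph \<Rightarrow> 'v set set \<Rightarrow> 'v graph" where
  "delete_edges G F = (verts G, edges G - F)"

definition connected_graph :: "'v graph \<Rightarrow> bool" where
  "connected_graph G \<longleftrightarrow> verts G \<noteq> {} \<and>
     (\<forall>u\<in>verts G. \<forall>v\<in>verts G. (u, v) \<in> {(x, y). {x, y} \<in> edges G}\<^sup>*)"

text \<open>The size conditions in the next two definitions are the usual ones: a one-vertex graph is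
  not \<open>k\<close>-edge-connected, and a \<open>k\<close>-connected graph has more than \<open>k\<close> vertices.\<close>

definition edge_connected :: "nat \<Rightarrow> 'v graph \<Rightarrow> bool" where
  "edge_connected k G \<longleftrightarrow> card (verts G) \<ge> 2 \<and>
     (\<forall>F\<subseteq>edges G. card F < k \<longrightarrow> connected_graph (delete_edges G F))"

definition vertex_connected :: "nat \<Rightarrow> 'v graph \<Rightarrow> bool" where
  "vertex_connected k G \<longleftrightarrow> card (verts G) > k \<and>
     (\<forall>U\<subseteq>verts G. card U < k \<longrightarrow> connected_graph (delete_verts G U))"

section \<open>Frameworks and infinitesimal rigidity in a normed space\<close>

text \<open>Here the vertex set is the whole finite type \<open>'v\<close>, so that \<open>'a ^ 'v\<close> is
  the space of placements, and a graph is given by its edge set \<open>E\<close>.\<close>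

definition framework :: "'v set set \<Rightarrow> 'a::real_normed_vector ^ 'v::finite \<Rightarrow> bool" where
  "framework E p \<longleftrightarrow> (\<forall>v w. {v, w} \<in> E \<longrightarrow> p $ v \<noteq> p $ w)"

definition edge_length :: "'a::real_normed_vector ^ 'v::finite \<Rightarrow> 'v set \<Rightarrow> real" where
  "edge_length x e = (THE l. \<exists>v w. e = {v, w} \<and> l = norm (x $ v - x $ w))"

lemma edge_length_doubleton: "edge_length x {v, w} = norm (x $ v - x $ w)"
  unfolding edge_length_def
  by (rule the_equality) (auto simp: doubleton_eq_iff norm_minus_commute)

text \<open>The codomain of the rigidity map, real vectors indexed by \<open>E\<close>, is embedded into the real
  vectors indexed by all sets of vertices, with coordinate 0 outside \<open>E\<close>.\<close>

definition rigidity_map ::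
    "'v set set \<Rightarrow> 'a::real_normed_vector ^ 'v::finite \<Rightarrow> real ^ ('v set)" where
  "rigidity_map E x = (\<chi> e. if e \<in> E then edge_length x e else 0)"

definition well_positioned :: "'v set set \<Rightarrow> 'a::real_normed_vector ^ 'v::finite \<Rightarrow> bool" where
  "well_positioned E p \<longleftrightarrow> rigidity_map E differentiable (at p)"

definition rigid_motion :: "('a::real_normed_vector \<Rightarrow> real \<Rightarrow> 'a) \<Rightarrow> bool" where
  "rigid_motion \<alpha> \<longleftrightarrow>
     (\<forall>x. continuous_on {-1..1} (\<alpha> x) \<and> \<alpha> x 0 = x \<and>
          \<alpha> x differentiable (at 0 within {-1..1})) \<and>
     (\<forall>x y. \<forall>t\<in>{-1..1}. norm (\<alpha> x t - \<alpha> y t) = norm (x - y))"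

definition infinitesimal_rigid_motions :: "('a::real_normed_vector \<Rightarrow> 'a) set" where
  "infinitesimal_rigid_motions =
     {\<eta>. \<exists>\<alpha>. rigid_motion \<alpha> \<and>
              (\<forall>x. (\<alpha> x has_vector_derivative \<eta> x) (at 0 within {-1..1}))}"

definition trivial_motions ::
    "'a::real_normed_vector ^ 'v::finite \<Rightarrow> ('a ^ 'v) set" where
  "trivial_motions p = {(\<chi> v. \<eta> (p $ v)) | \<eta>. \<eta> \<in> infinitesimal_rigid_motions}"

definition infinitesimally_rigid ::
    "'v set set \<Rightarrow> 'a::real_normed_vector ^ 'v::finite \<Rightarrow> bool" where
  "infinitesimally_rigid E p \<longleftrightarrow>
     {u. frechet_derivative (rigidity_map E) (at p) u = 0} = trivial_motions p"

definition rigid_in :: "'a::real_normed_vector itself \<Rightarrow> 'v::finite set set \<Rightarrow> bool" where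
  "rigid_in Y E \<longleftrightarrow>
     (\<exists>p :: 'a ^ 'v. framework E p \<and> well_positioned E p \<and> infinitesimally_rigid E p)"

section \<open>The cylindrical normed space\<close>

text \<open>The library's norm on the product type \<open>'a \<times> 'b\<close> is the Euclidean combination of the two norms,
  so the direct sum with the maximum norm needs a type of its own.\<close>

datatype ('a, 'b) linf_sum = Linf (linf_fst: 'a) (linf_snd: 'b)

instantiation linf_sum :: (real_normed_vector, real_normed_vector) real_normed_vector
begin

definition zero_linf_sum :: "('a, 'b) linf_sum" where
  "0 = Linf 0 0"

definition plus_linf_sum :: "('a, 'b) linf_sum \<Rightarrow> ('a, 'b) linf_sum \<Rightarrow> ('a, 'b) linf_sum" where
  "z + w = Linf (linf_fst z + linf_fst w) (linf_snd z + linf_snd w)"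

definition minus_linf_sum :: "('a, 'b) linf_sum \<Rightarrow> ('a, 'b) linf_sum \<Rightarrow> ('a, 'b) linf_sum" where
  "z - w = Linf (linf_fst z - linf_fst w) (linf_snd z - linf_snd w)"

definition uminus_linf_sum :: "('a, 'b) linf_sum \<Rightarrow> ('a, 'b) linf_sum" where
  "- z = Linf (- linf_fst z) (- linf_snd z)"

definition scaleR_linf_sum :: "real \<Rightarrow> ('a, 'b) linf_sum \<Rightarrow> ('a, 'b) linf_sum" where
  "c *\<^sub>R z = Linf (c *\<^sub>R linf_fst z) (c *\<^sub>R linf_snd z)"

definition norm_linf_sum :: "('a, 'b) linf_sum \<Rightarrow> real" where
  "norm z = max (norm (linf_fst z)) (norm (linf_snd z))"

definition sgn_linf_sum :: "('a, 'b) linf_sum \<Rightarrow> ('a, 'b) linf_sum" where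
  "sgn (z :: ('a, 'b) linf_sum) = inverse (norm z) *\<^sub>R z"

definition dist_linf_sum :: "('a, 'b) linf_sum \<Rightarrow> ('a, 'b) linf_sum \<Rightarrow> real" where
  "dist (z :: ('a, 'b) linf_sum) w = norm (z - w)"

definition uniformity_linf_sum :: "(('a, 'b) linf_sum \<times> ('a, 'b) linf_sum) filter" where
  "uniformity_linf_sum = (INF e\<in>{0 <..}. principal {(z :: ('a, 'b) linf_sum, w). dist z w < e})"

definition open_linf_sum :: "('a, 'b) linf_sum set \<Rightarrow> bool" where
  "open_linf_sum (U :: ('a, 'b) linf_sum set) \<longleftrightarrow> (\<forall>z\<in>U. eventually (\<lambda>(z', w). z' = z \<longrightarrow> w \<in> U) uniformity)"

instance
proof
  fix z w :: "('a, 'b) linf_sum" and c :: real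
  show "norm (z + w) \<le> norm z + norm w"
    unfolding norm_linf_sum_def plus_linf_sum_def
    using norm_triangle_ineq[of "linf_fst z" "linf_fst w"]
      norm_triangle_ineq[of "linf_snd z" "linf_snd w"] by auto
  show "norm (c *\<^sub>R z) = \<bar>c\<bar> * norm z"
    by (simp add: norm_linf_sum_def scaleR_linf_sum_def max_mult_distrib_left)
  show "(norm z = 0) = (z = 0)"
    by (cases z) (auto simp: norm_linf_sum_def zero_linf_sum_def max_def)
qed (auto simp: zero_linf_sum_def plus_linf_sum_def minus_linf_sum_def uminus_linf_sum_def
    scaleR_linf_sum_def sgn_linf_sum_def dist_linf_sum_def uniformity_linf_sum_def
    open_linf_sum_def algebra_simps split: linf_sum.splits)

end

type_synonym cylinder = "(real ^ 2, real) linf_sum"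

end

theory Submission imports Defs begin

text \<open>A pair at which the planar and the vertical part of the difference have different norms contributes to
  the rigidity map only through the larger of the two. Hence a framework is infinitesimally rigid as soon as
  its vertical edges contain a spanning tree \<open>T\<close> and its planar edges contain a spanning subgraph \<open>H\<close>
  that is infinitesimally rigid in the plane.

  For every spanning tree there is a placement in which the vertical pairs are exactly the tree edges, and this
  is stable under small perturbations of the planar coordinates. Frameworks on a Laman graph are rigid for a dense
  set of planar placements, so any Laman graph edge-disjoint from \<open>T\<close> serves as \<open>H\<close>.

  That a Laman graph and a spanning tree can be packed follows from matroid intersection for the
  \<open>(2,3)\<close>-count matroid and the dual of the \<open>(1,1)\<close>-count matroid. The rank condition is
  checked on the decomposition of an edge set into blocks that the count matroids provide, by a discharging argument
  in the style of Lovasz and Yemini.\<close>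

section \<open>Matroid intersection\<close>

text \<open>The edge counts are forced. For \<open>n\<close> vertices a placement has
  \<open>3 * n\<close> coordinates; a planar rotation, two planar translations and a vertical
  translation account for 4 dimensions of motions, and a Laman graph with a spanning tree has
  \<open>(2 * n - 3) + (n - 1) = 3 * n - 4\<close> edges. Dualizing the tree matroid turns
  edge-disjointness into common independence: a set is independent in the dual exactly if its
  complement keeps the full tree rank. Connectivity enters only through
  \<open>mixed_connected\<close>, the uniform bound \<open>8 - 2 * card U\<close> for cuts after
  deletion of \<open>U\<close>. Conditions (i) to (iv) are its cases with at most three deleted
  vertices, and 8-connectivity implies it as well, so both claims share one proof. Edges outside the
  tree and the Laman graph can only shrink the kernel, which contains the trivial motions in any
  case.\<close>

definition rank_function :: "'e set \<Rightarrow> ('e set \<Rightarrow> int) \<Rightarrow> bool" where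
  "rank_function E r \<longleftrightarrow> r {} = 0 \<and> (\<forall>e\<in>E. r {e} \<le> 1) \<and>
     (\<forall>A B. A \<subseteq> B \<and> B \<subseteq> E \<longrightarrow> r A \<le> r B) \<and>
     (\<forall>A B. A \<subseteq> E \<and> B \<subseteq> E \<longrightarrow> r (A \<union> B) + r (A \<inter> B) \<le> r A + r B)"

lemma rank_function_empty: "rank_function E r \<Longrightarrow> r {} = 0"
  and rank_function_singleton: "rank_function E r \<Longrightarrow> e \<in> E \<Longrightarrow> r {e} \<le> 1"
  and rank_function_mono: "rank_function E r \<Longrightarrow> A \<subseteq> B \<Longrightarrow> B \<subseteq> E \<Longrightarrow> r A \<le> r B"
  and rank_function_submodular:
    "rank_function E r \<Longrightarrow> A \<subseteq> E \<Longrightarrow> B \<subseteq> E \<Longrightarrow> r (A \<union> B) + r (A \<inter> B) \<le> r A + r B"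
  unfolding rank_function_def by blast+

lemma rank_function_nonneg: "rank_function E r \<Longrightarrow> A \<subseteq> E \<Longrightarrow> 0 \<le> r A"
  using rank_function_mono[of E r "{}" A] by (simp add: rank_function_empty)

lemma rank_function_insert_le:
  assumes "rank_function E r" "A \<subseteq> E" "e \<in> E"
  shows "r (insert e A) \<le> r A + r {e}"
proof -
  have "r (A \<union> {e}) + r (A \<inter> {e}) \<le> r A + r {e}"
    using assms by (intro rank_function_submodular) auto
  moreover have "0 \<le> r (A \<inter> {e})"
    using assms by (intro rank_function_nonneg) auto
  ultimately show ?thesis by simp
qed

lemma rank_function_le_card:
  assumes "rank_function E r" "finite B" "A \<union> B \<subseteq> E"
  shows "r (A \<union> B) \<le> r A + int (card B)"
  using assms(2,3)
proof (induction B rule: finite_induct)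
  case (insert e B)
  then have "r (insert e (A \<union> B)) \<le> r (A \<union> B) + r {e}" "r {e} \<le> 1"
    using assms(1) by (auto intro!: rank_function_insert_le rank_function_singleton)
  with insert show ?case by auto
qed simp

lemma rank_function_loops:
  assumes "rank_function E r" "finite A" "A \<subseteq> E" "\<And>e. e \<in> A \<Longrightarrow> r {e} = 0"
  shows "r A = 0"
  using assms(2-4)
proof (induction A rule: finite_induct)
  case empty then show ?case using assms(1) by (simp add: rank_function_empty)
next
  case (insert e A)
  then have "r (insert e A) \<le> 0"
    using rank_function_insert_le[OF assms(1), of A e] by auto
  then show ?case using insert rank_function_nonneg[OF assms(1), of "insert e A"] by auto
qed

lemma rank_function_delete: "rank_function E r \<Longrightarrow> E' \<subseteq> E \<Longrightarrow> rank_function E' r"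
  unfolding rank_function_def by (meson subset_trans subsetD)

text \<open>Contraction of a non-loop: \<open>r {e} = 1\<close> makes the value at the empty set 0.
  Integer values keep the subtraction exact, here and in the dual.\<close>

lemma rank_function_contract:
  assumes r: "rank_function E r" and e: "e \<in> E" "r {e} = 1"
  shows "rank_function (E - {e}) (\<lambda>A. r (insert e A) - 1)"
  unfolding rank_function_def
proof (intro conjI ballI allI impI)
  fix A B assume *: "A \<subseteq> E - {e} \<and> B \<subseteq> E - {e}"
  have "r (insert e A \<union> insert e B) + r (insert e A \<inter> insert e B) \<le> r (insert e A) + r (insert e B)"
    by (rule rank_function_submodular[OF r]) (use * e in auto)
  moreover have "insert e A \<union> insert e B = insert e (A \<union> B)" "insert e A \<inter> insert e B = insert e (A \<inter> B)"
    by auto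
  ultimately show "r (insert e (A \<union> B)) - 1 + (r (insert e (A \<inter> B)) - 1)
      \<le> r (insert e A) - 1 + (r (insert e B) - 1)"
    by simp
next
  fix f assume "f \<in> E - {e}"
  then show "r {e, f} - 1 \<le> 1"
    using rank_function_insert_le[OF r, of "{f}" e] rank_function_singleton[OF r, of f] e by auto
next
  fix A B assume "A \<subseteq> B \<and> B \<subseteq> E - {e}"
  then show "r (insert e A) - 1 \<le> r (insert e B) - 1"
    using rank_function_mono[OF r, of "insert e A" "insert e B"] e
    by (metis diff_right_mono insert_mono insert_subset subset_Diff_insert subset_insert_iff
        Diff_subset subset_trans)
qed (use e in auto)

text \<open>Delete or contract an element that is a loop of neither matroid: if the bound fails both for the
  deletion and for the contraction, two submodularity inequalities contradict the bound for \<open>E\<close>.\<close>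

theorem matroid_intersection:
  assumes "finite E" "rank_function E f" "rank_function E g"
    and "\<And>A. A \<subseteq> E \<Longrightarrow> int k \<le> f A + g (E - A)"
  shows "\<exists>I\<subseteq>E. card I = k \<and> f I = int k \<and> g I = int k"
  using assms
proof (induction "card E" arbitrary: E f g k rule: less_induct)
  case less
  note fin = less.prems(1) and f = less.prems(2) and g = less.prems(3) and bound = less.prems(4)
  show ?case
  proof (cases "k = 0")
    case True
    then show ?thesis
      using f g by (intro exI[of _ "{}"]) (auto simp: rank_function_empty)
  next
    case False
    have "\<exists>e\<in>E. f {e} = 1 \<and> g {e} = 1"
    proof (rule ccontr)
      assume no: "\<not> ?thesis"
      \<comment> \<open>Otherwise every element is a loop of \<open>f\<close> or of
        \<open>g\<close>, and the bound at the set of loops of \<open>f\<close> reads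
        \<open>k \<le> 0\<close>.\<close>
      let ?A = "{e \<in> E. f {e} = 0}"
      have loop: "f {e} = 0 \<or> g {e} = 0" if e: "e \<in> E" for e
      proof -
        have "f {e} \<le> 1" "g {e} \<le> 1"
          using rank_function_singleton[OF f e] rank_function_singleton[OF g e] .
        moreover have "0 \<le> f {e}" "0 \<le> g {e}"
          by (rule rank_function_nonneg[OF f], use e in simp)
             (rule rank_function_nonneg[OF g], use e in simp)
        ultimately show ?thesis using no e by force
      qed
      have "f ?A = 0" 
        by (rule rank_function_loops[OF f]) (use fin in auto)
      moreover have "g (E - ?A) = 0"
        by (rule rank_function_loops[OF g]) (use fin loop in auto)
      moreover have "int k \<le> f ?A + g (E - ?A)" by (rule bound) auto
      ultimately show False using False by linarith
    qed
    then obtain e where e: "e \<in> E" "f {e} = 1" "g {e} = 1" by blast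
    let ?E = "E - {e}"
    have smaller: "card ?E < card E" by (rule card_Diff1_less[OF fin e(1)])
    show ?thesis
    proof (cases "\<forall>A\<subseteq>?E. int k \<le> f A + g (?E - A)")
      case True
      have "\<exists>I\<subseteq>?E. card I = k \<and> f I = int k \<and> g I = int k"
        using less.hyps[OF smaller _ rank_function_delete[OF f] rank_function_delete[OF g]] True fin
        by auto
      then show ?thesis by blast
    next
      case nodel: False
      then obtain A where A: "A \<subseteq> ?E" "f A + g (?E - A) < int k" by auto
      let ?f = "\<lambda>A. f (insert e A) - 1" and ?g = "\<lambda>A. g (insert e A) - 1"
      have "int (k - 1) \<le> ?f B + ?g (?E - B)" if B: "B \<subseteq> ?E" for B
      proof (rule ccontr)
        assume "\<not> ?thesis"
        moreover have "insert e (?E - B) = E - B" using e B by auto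
        \<comment> \<open>Two ones are subtracted while \<open>k\<close> drops by only one, so this
          bound is not strict; the strict failure at \<open>A\<close> supplies the unit missing from
          \<open>2 * k\<close>.\<close>
        ultimately have 1: "f (insert e B) + g (E - B) \<le> int k" using False by auto
        have "f (A \<union> insert e B) + f (A \<inter> insert e B) \<le> f A + f (insert e B)"
          by (rule rank_function_submodular[OF f]) (use A B e in auto)
        moreover have "(?E - A) \<union> (E - B) = E - (A \<inter> insert e B)"
          "(?E - A) \<inter> (E - B) = E - (A \<union> insert e B)" using A B e by auto
        then have "g (E - (A \<inter> insert e B)) + g (E - (A \<union> insert e B)) \<le> g (?E - A) + g (E - B)"
          using rank_function_submodular[OF g, of "?E - A" "E - B"] by auto
        moreover have "int k \<le> f (A \<inter> insert e B) + g (E - (A \<inter> insert e B))"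
          "int k \<le> f (A \<union> insert e B) + g (E - (A \<union> insert e B))"
          using A B e by (auto intro!: bound)
        ultimately show False using 1 A(2) by linarith
      qed
      then obtain I where I: "I \<subseteq> ?E" "card I = k - 1" "?f I = int (k - 1)" "?g I = int (k - 1)"
        using less.hyps[OF smaller _ rank_function_contract[OF f] rank_function_contract[OF g],
            where k = "k - 1"] e fin by auto
      then have "card (insert e I) = k" 
        using False fin finite_subset[OF I(1)] by (subst card_insert_disjoint) auto
      then show ?thesis
        using I e False by (intro exI[of _ "insert e I"]) auto
    qed
  qed
qed

text \<open>The dual rank equals \<open>card A\<close> exactly when removing \<open>A\<close> keeps
  the full rank of \<open>E\<close>; this is how a set is required to leave a spanning tree in its
  complement.\<close>

lemma rank_function_dual:
  assumes r: "rank_function E r" and fin: "finite E"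
  shows "rank_function E (\<lambda>A. int (card A) + r (E - A) - r E)"
proof -
  have mono: "int (card A) + r (E - A) \<le> int (card B) + r (E - B)" if "A \<subseteq> B" "B \<subseteq> E" for A B
  proof -
    have "r ((E - B) \<union> (B - A)) \<le> r (E - B) + int (card (B - A))"
      by (rule rank_function_le_card[OF r]) (use that fin in \<open>auto intro: finite_subset\<close>)
    moreover have "(E - B) \<union> (B - A) = E - A" using that by auto
    moreover have "card B = card A + card (B - A)"
      using that fin by (metis card_Diff_subset card_mono finite_subset le_add_diff_inverse)
    ultimately show ?thesis by simp
  qed
  have sub: "int (card (A \<union> B)) + r (E - (A \<union> B)) + (int (card (A \<inter> B)) + r (E - (A \<inter> B)))
      \<le> int (card A) + r (E - A) + (int (card B) + r (E - B))" if "A \<subseteq> E" "B \<subseteq> E" for A B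
  proof -
    have "r ((E - A) \<union> (E - B)) + r ((E - A) \<inter> (E - B)) \<le> r (E - A) + r (E - B)"
      by (rule rank_function_submodular[OF r]) auto
    moreover have "(E - A) \<union> (E - B) = E - (A \<inter> B)" "(E - A) \<inter> (E - B) = E - (A \<union> B)" by auto
    moreover have "card A + card B = card (A \<union> B) + card (A \<inter> B)"
      using that fin by (intro card_Un_Int) (auto intro: finite_subset)
    ultimately show ?thesis by simp
  qed
  show ?thesis
    unfolding rank_function_def
  proof (intro conjI ballI allI impI)
    fix A B assume "A \<subseteq> B \<and> B \<subseteq> E"
    then show "int (card A) + r (E - A) - r E \<le> int (card B) + r (E - B) - r E"
      using mono[of A B] by auto
  next
    fix A B assume "A \<subseteq> E \<and> B \<subseteq> E"
    then show "int (card (A \<union> B)) + r (E - (A \<union> B)) - r E + (int (card (A \<inter> B)) + r (E - (A \<inter> B)) - r E)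
      \<le> int (card A) + r (E - A) - r E + (int (card B) + r (E - B) - r E)"
      using sub[of A B] by auto
  next
    fix e assume "e \<in> E"
    then show "int (card {e}) + r (E - {e}) - r E \<le> 1"
      using rank_function_mono[OF r, of "E - {e}" E] by auto
  qed auto
qed

section \<open>Count matroids\<close>

definition induced :: "'v set set \<Rightarrow> 'v set \<Rightarrow> 'v set set" where
  "induced F X = {e \<in> F. e \<subseteq> X}"

text \<open>For simple graphs, \<open>count_sparse 2 3\<close> is Laman sparsity and
  \<open>count_sparse 1 1\<close> means forest. The guard exempts sets too small for the bound; the
  additive form avoids truncated subtraction.\<close>

definition count_sparse :: "nat \<Rightarrow> nat \<Rightarrow> 'v::finite set set \<Rightarrow> bool" where
  "count_sparse k l F \<longleftrightarrow> (\<forall>X. l \<le> k * card X \<longrightarrow> card (induced F X) + l \<le> k * card X)"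

definition sparse_rank :: "nat \<Rightarrow> nat \<Rightarrow> 'v::finite set set \<Rightarrow> nat" where
  "sparse_rank k l F = Max (card ` {I. I \<subseteq> F \<and> count_sparse k l I})"

lemma count_sparse_empty [simp]: "count_sparse k l {}"
  by (simp add: count_sparse_def induced_def)

lemma induced_mono: "F \<subseteq> F' \<Longrightarrow> induced F X \<subseteq> induced F' X"
  by (auto simp: induced_def)

lemma count_sparse_subset: "count_sparse k l F \<Longrightarrow> F' \<subseteq> F \<Longrightarrow> count_sparse k l F'"
  unfolding count_sparse_def
  by (meson add_le_mono1 card_mono finite induced_mono order_trans)

lemma sparse_rank_ge: "I \<subseteq> F \<Longrightarrow> count_sparse k l I \<Longrightarrow> card I \<le> sparse_rank k l F"
  unfolding sparse_rank_def by (rule Max_ge) auto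

lemma sparse_rank_attained: "\<exists>I\<subseteq>F. count_sparse k l I \<and> card I = sparse_rank k l F"
proof -
  have "sparse_rank k l F \<in> card ` {I. I \<subseteq> F \<and> count_sparse k l I}"
    unfolding sparse_rank_def by (rule Max_in) (auto intro: exI[of _ "{}"])
  then show ?thesis by auto
qed

lemma card_induced_supermodular:
  fixes F :: "'v::finite set set"
  shows "card (induced F X) + card (induced F Y)
    \<le> card (induced F (X \<union> Y)) + card (induced F (X \<inter> Y))"
proof -
  have "card (induced F X) + card (induced F Y)
      = card (induced F X \<union> induced F Y) + card (induced F X \<inter> induced F Y)"
    by (rule card_Un_Int) auto
  also have "card (induced F X \<union> induced F Y) \<le> card (induced F (X \<union> Y))"
    by (rule card_mono) (auto simp: induced_def)
  also have "induced F X \<inter> induced F Y = induced F (X \<inter> Y)"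
    by (auto simp: induced_def)
  finally show ?thesis by simp
qed

lemma sum_induced_ge:
  fixes F :: "'v::finite set set"
  assumes "\<And>e. e \<in> F \<Longrightarrow> \<exists>X\<in>\<X>. e \<subseteq> X"
  shows "card F \<le> (\<Sum>X\<in>\<X>. card (induced F X))"
proof -
  have "F \<subseteq> (\<Union>X\<in>\<X>. induced F X)" using assms by (fastforce simp: induced_def)
  then have "card F \<le> card (\<Union>X\<in>\<X>. induced F X)" by (rule card_mono[rotated]) auto
  also have "\<dots> \<le> (\<Sum>X\<in>\<X>. card (induced F X))" by (rule card_UN_le) auto
  finally show ?thesis .
qed

text \<open>The blocks are the maximal tight sets. Since \<open>l + 1 = 2 * k\<close>, a single edge is tight, and two
  tight sets whose intersection has at least \<open>l / k\<close> vertices have a tight union.\<close>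

lemma maximal_sparse_blocks:
  fixes F :: "'v::finite set set"
  assumes kl: "Suc l = 2 * k" and F: "\<And>e. e \<in> F \<Longrightarrow> card e = 2"
    and I: "I \<subseteq> F" "count_sparse k l I" and maximal: "\<And>e. e \<in> F - I \<Longrightarrow> \<not> count_sparse k l (insert e I)"
  obtains \<X> where "\<And>X. X \<in> \<X> \<Longrightarrow> l \<le> k * card X"
    "\<And>X Y. X \<in> \<X> \<Longrightarrow> Y \<in> \<X> \<Longrightarrow> X \<noteq> Y \<Longrightarrow> k * card (X \<inter> Y) < l"
    "\<And>e. e \<in> F \<Longrightarrow> \<exists>X\<in>\<X>. e \<subseteq> X"
    "\<And>Y. k * card Y = l \<Longrightarrow> \<exists>X\<in>\<X>. Y \<subseteq> X"
    "card I = (\<Sum>X\<in>\<X>. k * card X - l)"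
proof -
  define tight where "tight X \<longleftrightarrow> l \<le> k * card X \<and> card (induced I X) + l = k * card X" for X
  define \<X> where "\<X> = {X. tight X \<and> (\<forall>Y. tight Y \<longrightarrow> X \<subseteq> Y \<longrightarrow> Y = X)}"
  have I_le: "card (induced I X) + l \<le> k * card X" if "l \<le> k * card X" for X
    using I(2) that by (auto simp: count_sparse_def)
  have extend: "\<exists>Y\<in>\<X>. X \<subseteq> Y" if "tight X" for X
  proof -
    obtain Y where Y: "tight Y" "X \<subseteq> Y" "\<forall>Z. tight Z \<and> X \<subseteq> Z \<longrightarrow> Y \<subseteq> Z \<longrightarrow> Y = Z"
      using finite_has_maximal2[of "{Y. tight Y \<and> X \<subseteq> Y}" X] \<open>tight X\<close> by auto
    then have "Y \<in> \<X>" unfolding \<X>_def by blast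
    then show ?thesis using Y(2) by blast
  qed
  have inter: "k * card (X \<inter> Y) < l" if "X \<in> \<X>" "Y \<in> \<X>" "X \<noteq> Y" for X Y
  proof (rule ccontr)
    assume "\<not> ?thesis"
    then have big: "l \<le> k * card (X \<inter> Y)" by simp
    have "card (X \<inter> Y) \<le> card (X \<union> Y)" by (intro card_mono) auto
    then have big': "l \<le> k * card (X \<union> Y)" using big mult_le_mono2 order_trans by blast
    have "k * card X + k * card Y = k * card (X \<union> Y) + k * card (X \<inter> Y)"
      using card_Un_Int[of X Y] by (metis distrib_left finite)
    moreover have "tight X" "tight Y" using that by (auto simp: \<X>_def)
    ultimately have "tight (X \<union> Y)"
      using I_le[OF big] I_le[OF big'] card_induced_supermodular[of I X Y] big'
      unfolding tight_def by linarith
    then have "X \<union> Y = X" "X \<union> Y = Y" using that(1,2) unfolding \<X>_def by blast+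
    then show False using that(3) by blast
  qed
  have cover: "\<exists>X\<in>\<X>. e \<subseteq> X" if e: "e \<in> F" for e
  proof (cases "e \<in> I")
    case True
    have "card (induced I e) \<ge> card {e}" by (rule card_mono) (use True in \<open>auto simp: induced_def\<close>)
    then have "tight e" using I_le[of e] kl F[OF e] by (auto simp: tight_def)
    then show ?thesis by (rule extend)
  next
    case False
    \<comment> \<open>A set that breaks the bound must contain \<open>e\<close>, and since one edge
      suffices to break it, it was already tight for \<open>I\<close>.\<close>
    then obtain X where X: "l \<le> k * card X" "\<not> card (induced (insert e I) X) + l \<le> k * card X"
      using maximal[of e] e by (auto simp: count_sparse_def)
    have "e \<subseteq> X"
    proof (rule ccontr)
      assume "\<not> e \<subseteq> X"
      then have "induced (insert e I) X = induced I X" by (auto simp: induced_def)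
      then show False using X I_le[of X] by simp
    qed
    have "card (induced (insert e I) X) \<le> card (insert e (induced I X))"
      by (rule card_mono) (auto simp: induced_def)
    also have "\<dots> \<le> Suc (card (induced I X))" by (simp add: card_insert_if)
    finally have "tight X" using X I_le[of X] unfolding tight_def by linarith
    then show ?thesis using extend[of X] \<open>e \<subseteq> X\<close> by blast
  qed
  \<comment> \<open>The bound leaves such a set no room for an edge, so it is tight. For
    \<open>k = l = 1\<close> these are the singletons, so the blocks then cover every
    vertex.\<close>
  have small: "\<exists>X\<in>\<X>. Y \<subseteq> X" if "k * card Y = l" for Y
    using I_le[of Y] that by (intro extend) (auto simp: tight_def)
  have "I = (\<Union>X\<in>\<X>. induced I X)"
  proof
    show "I \<subseteq> (\<Union>X\<in>\<X>. induced I X)"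
    proof
      fix e assume "e \<in> I"
      moreover then obtain X where "X \<in> \<X>" "e \<subseteq> X" using cover I(1) by blast
      ultimately show "e \<in> (\<Union>X\<in>\<X>. induced I X)" by (auto simp: induced_def)
    qed
  qed (auto simp: induced_def)
  then have "card I = card (\<Union>X\<in>\<X>. induced I X)" by (rule arg_cong)
  also have "\<dots> = (\<Sum>X\<in>\<X>. card (induced I X))"
  proof (rule card_UN_disjoint)
    show "\<forall>X\<in>\<X>. \<forall>Y\<in>\<X>. X \<noteq> Y \<longrightarrow> induced I X \<inter> induced I Y = {}"
    proof (intro ballI impI, rule ccontr)
      fix X Y assume XY: "X \<in> \<X>" "Y \<in> \<X>" "X \<noteq> Y" "induced I X \<inter> induced I Y \<noteq> {}"
      then obtain e where e: "e \<in> I" "e \<subseteq> X \<inter> Y" by (auto simp: induced_def)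
      \<comment> \<open>A common edge means two common vertices, and \<open>k * 2 = l + 1\<close>
        exceeds the permitted overlap.\<close>
      then have "2 \<le> card (X \<inter> Y)" using F[of e] I(1) card_mono[OF _ e(2)] by auto
      then have "k * 2 \<le> k * card (X \<inter> Y)" by (rule mult_le_mono2)
      then show False using inter[OF XY(1-3)] kl by linarith
    qed
  qed simp_all
  also have "\<dots> = (\<Sum>X\<in>\<X>. k * card X - l)"
    by (rule sum.cong) (auto simp: \<X>_def tight_def)
  finally have "card I = (\<Sum>X\<in>\<X>. k * card X - l)" .
  moreover have "l \<le> k * card X" if "X \<in> \<X>" for X using that by (simp add: \<X>_def tight_def)
  ultimately show thesis using inter cover small by (intro that[of \<X>])
qed

text \<open>The easy half of a min-max formula for the rank: each edge is charged to a set of the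
  cover that contains it. The blocks attain the bound.\<close>

lemma sparse_card_le_blocks:
  fixes J :: "'v::finite set set"
  assumes "count_sparse k l J" "\<And>X. X \<in> \<X> \<Longrightarrow> l \<le> k * card X" "\<And>e. e \<in> J \<Longrightarrow> \<exists>X\<in>\<X>. e \<subseteq> X"
  shows "card J \<le> (\<Sum>X\<in>\<X>. k * card X - l)"
proof -
  have "card J \<le> (\<Sum>X\<in>\<X>. card (induced J X))" using assms(3) by (rule sum_induced_ge)
  also have "\<dots> \<le> (\<Sum>X\<in>\<X>. k * card X - l)"
    using assms(1,2) by (intro sum_mono) (simp add: count_sparse_def le_diff_conv2)
  finally show ?thesis .
qed

text \<open>The matroid property: the blocks of a maximal sparse \<open>I\<close> cover
  \<open>F\<close>, so their count, which is \<open>card I\<close>, bounds every other sparse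
  subset.\<close>

lemma maximal_sparse_card:
  fixes F :: "'v::finite set set"
  assumes "Suc l = 2 * k" "\<And>e. e \<in> F \<Longrightarrow> card e = 2"
    and "I \<subseteq> F" "count_sparse k l I" "\<And>e. e \<in> F - I \<Longrightarrow> \<not> count_sparse k l (insert e I)"
  shows "card I = sparse_rank k l F"
proof (rule antisym)
  obtain J where J: "J \<subseteq> F" "count_sparse k l J" "card J = sparse_rank k l F"
    using sparse_rank_attained by blast
  obtain \<X> where \<X>: "\<And>X. X \<in> \<X> \<Longrightarrow> l \<le> k * card X" "\<And>e. e \<in> F \<Longrightarrow> \<exists>X\<in>\<X>. e \<subseteq> X"
    "card I = (\<Sum>X\<in>\<X>. k * card X - l)"
    by (rule maximal_sparse_blocks[OF assms(1) _ assms(3,4)]) (use assms in auto)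
  have "card J \<le> (\<Sum>X\<in>\<X>. k * card X - l)"
    by (rule sparse_card_le_blocks[OF J(2)]) (use \<X> J(1) in auto)
  then show "sparse_rank k l F \<le> card I" using \<X>(3) J(3) by simp
qed (rule sparse_rank_ge[OF assms(3,4)])

lemma sparse_extend:
  fixes F :: "'v::finite set set"
  assumes "Suc l = 2 * k" "\<And>e. e \<in> F \<Longrightarrow> card e = 2" "I \<subseteq> F" "count_sparse k l I"
  shows "\<exists>J\<subseteq>F. I \<subseteq> J \<and> count_sparse k l J \<and> card J = sparse_rank k l F"
proof -
  let ?S = "{J. J \<subseteq> F \<and> I \<subseteq> J \<and> count_sparse k l J}"
  have "finite ?S" "I \<in> ?S" using assms by auto
  then obtain J where J: "J \<in> ?S" "I \<subseteq> J" "\<forall>K\<in>?S. J \<subseteq> K \<longrightarrow> J = K"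
    by (meson finite_has_maximal2)
  have "\<not> count_sparse k l (insert e J)" if "e \<in> F - J" for e
  proof
    assume "count_sparse k l (insert e J)"
    then have "insert e J \<in> ?S" using J(1) that by auto
    with J(3) have "J \<subseteq> insert e J \<longrightarrow> J = insert e J" by (rule bspec)
    then show False using that by blast
  qed
  then have "card J = sparse_rank k l F"
    using J(1) assms(1,2) by (intro maximal_sparse_card) auto
  then show ?thesis using J(1) by auto
qed

lemma sparse_rank_blocks:
  fixes F :: "'v::finite set set"
  assumes "Suc l = 2 * k" "\<And>e. e \<in> F \<Longrightarrow> card e = 2"
  obtains \<X> where "\<And>X. X \<in> \<X> \<Longrightarrow> l \<le> k * card X"
    "\<And>X Y. X \<in> \<X> \<Longrightarrow> Y \<in> \<X> \<Longrightarrow> X \<noteq> Y \<Longrightarrow> k * card (X \<inter> Y) < l"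
    "\<And>e. e \<in> F \<Longrightarrow> \<exists>X\<in>\<X>. e \<subseteq> X"
    "\<And>Y. k * card Y = l \<Longrightarrow> \<exists>X\<in>\<X>. Y \<subseteq> X"
    "sparse_rank k l F = (\<Sum>X\<in>\<X>. k * card X - l)"
proof -
  obtain I where I: "I \<subseteq> F" "count_sparse k l I" "card I = sparse_rank k l F"
    using sparse_rank_attained by blast
  have "\<not> count_sparse k l (insert e I)" if "e \<in> F - I" for e
  proof
    assume "count_sparse k l (insert e I)"
    then have "card (insert e I) \<le> card I"
      using I that by (subst I(3)) (intro sparse_rank_ge, auto)
    then show False using that by simp
  qed
  note maximal = this
  show thesis
  proof (rule maximal_sparse_blocks[OF assms(1) _ I(1,2)])
    fix \<X> :: "'v set set"
    assume "\<And>X. X \<in> \<X> \<Longrightarrow> l \<le> k * card X"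
      "\<And>X Y. X \<in> \<X> \<Longrightarrow> Y \<in> \<X> \<Longrightarrow> X \<noteq> Y \<Longrightarrow> k * card (X \<inter> Y) < l"
      "\<And>e. e \<in> F \<Longrightarrow> \<exists>X\<in>\<X>. e \<subseteq> X" "\<And>Y. k * card Y = l \<Longrightarrow> \<exists>X\<in>\<X>. Y \<subseteq> X"
      "card I = (\<Sum>X\<in>\<X>. k * card X - l)"
    then show thesis using I(3) by (intro that[of \<X>]) simp_all
  qed (use assms(2) maximal in blast)+
qed

lemma rank_function_sparse_rank:
  fixes E :: "'v::finite set set"
  assumes kl: "Suc l = 2 * k" and E: "\<And>e. e \<in> E \<Longrightarrow> card e = 2"
  shows "rank_function E (\<lambda>F. int (sparse_rank k l F))"
proof -
  have le_card: "sparse_rank k l F \<le> card F" for F :: "'v set set"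
  proof -
    obtain I where "I \<subseteq> F" "card I = sparse_rank k l F" using sparse_rank_attained by blast
    then show ?thesis using card_mono[of F I] by auto
  qed
  have mono: "sparse_rank k l A \<le> sparse_rank k l B" if "A \<subseteq> B" for A B :: "'v set set"
  proof -
    obtain I where "I \<subseteq> A" "count_sparse k l I" "card I = sparse_rank k l A"
      using sparse_rank_attained by blast
    then show ?thesis using sparse_rank_ge[of I B k l] that by auto
  qed
  have sub: "sparse_rank k l (A \<union> B) + sparse_rank k l (A \<inter> B) \<le> sparse_rank k l A + sparse_rank k l B"
    if AB: "A \<subseteq> E" "B \<subseteq> E" for A B
  proof -
    \<comment> \<open>Submodularity from bases: extend a largest sparse set of the intersection to
      one of the union and split the latter into its traces on \<open>A\<close> and
      \<open>B\<close>, which overlap in at least \<open>I\<close>.\<close>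
    obtain I where I: "I \<subseteq> A \<inter> B" "count_sparse k l I" "card I = sparse_rank k l (A \<inter> B)"
      using sparse_rank_attained by blast
    have "card e = 2" if "e \<in> A \<union> B" for e using that AB E by blast
    moreover have "I \<subseteq> A \<union> B" using I(1) by blast
    ultimately obtain J where J: "J \<subseteq> A \<union> B" "I \<subseteq> J" "count_sparse k l J" "card J = sparse_rank k l (A \<union> B)"
      using sparse_extend[OF kl, of "A \<union> B" I] I(2) by blast
    have "card J + card I \<le> card (J \<inter> A \<union> J \<inter> B) + card (J \<inter> A \<inter> (J \<inter> B))"
      using I(1) J(1,2) by (intro add_mono card_mono) auto
    also have "\<dots> = card (J \<inter> A) + card (J \<inter> B)"
      by (rule card_Un_Int[symmetric]) auto
    also have "\<dots> \<le> sparse_rank k l A + sparse_rank k l B"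
      by (intro add_mono sparse_rank_ge) (auto intro: count_sparse_subset[OF J(3)])
    finally show ?thesis using I(3) J(4) by simp
  qed
  show ?thesis
    unfolding rank_function_def
  proof (intro conjI ballI allI impI)
    show "int (sparse_rank k l ({} :: 'v set set)) = 0" using le_card[of "{}"] by simp
  next
    fix e :: "'v set" show "int (sparse_rank k l {e}) \<le> 1" using le_card[of "{e}"] by simp
  next
    fix A B :: "'v set set" assume "A \<subseteq> B \<and> B \<subseteq> E"
    then show "int (sparse_rank k l A) \<le> int (sparse_rank k l B)" using mono[of A B] by simp
  next
    fix A B :: "'v set set" assume "A \<subseteq> E \<and> B \<subseteq> E"
    then have "sparse_rank k l (A \<union> B) + sparse_rank k l (A \<inter> B) \<le> sparse_rank k l A + sparse_rank k l B"
      by (intro sub) auto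
    then show "int (sparse_rank k l (A \<union> B)) + int (sparse_rank k l (A \<inter> B))
        \<le> int (sparse_rank k l A) + int (sparse_rank k l B)" by linarith
  qed
qed

section \<open>Packing a Laman graph and a spanning tree\<close>

definition cut :: "'v set set \<Rightarrow> 'v set \<Rightarrow> 'v set \<Rightarrow> 'v set set" where
  "cut E S T = {e \<in> E. \<exists>s\<in>S. \<exists>t\<in>T. e = {s, t}}"

text \<open>Here \<open>U\<close> is the set of deleted vertices and \<open>S\<close> one side of a cut of the rest; the condition is
  void from \<open>card U = 4\<close> on.\<close>

definition mixed_connected :: "'v::finite set set \<Rightarrow> bool" where
  "mixed_connected E \<longleftrightarrow> (\<forall>U S. S \<noteq> {} \<longrightarrow> U \<inter> S = {} \<longrightarrow> U \<union> S \<noteq> UNIV \<longrightarrow>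
     8 \<le> card (cut E S (- (U \<union> S))) + 2 * card U)"

lemma sum_card_swap:
  assumes "finite A" "finite B"
  shows "(\<Sum>x\<in>A. card {y \<in> B. R x y}) = (\<Sum>y\<in>B. card {x \<in> A. R x y})"
  using sum_multicount_gen[OF assms, of R "\<lambda>y. card {x \<in> A. R x y}"] by simp

text \<open>At least 8 edges leave each class, by \<open>mixed_connected\<close> with nothing
  deleted, and an edge between classes meets only two of them.\<close>

lemma crossing_edges_ge:
  fixes E :: "'v::finite set set"
  assumes E: "\<And>e. e \<in> E \<Longrightarrow> card e = 2" and conn: "mixed_connected E"
    and \<C>: "\<Union>\<C> = UNIV" "\<And>C. C \<in> \<C> \<Longrightarrow> C \<noteq> {}"
      "\<And>C D. C \<in> \<C> \<Longrightarrow> D \<in> \<C> \<Longrightarrow> C \<noteq> D \<Longrightarrow> C \<inter> D = {}"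
    and two: "2 \<le> card \<C>"
  shows "4 * card \<C> \<le> card {e \<in> E. \<not> (\<exists>C\<in>\<C>. e \<subseteq> C)}"
proof -
  let ?X = "{e \<in> E. \<not> (\<exists>C\<in>\<C>. e \<subseteq> C)}"
  have uniq: "C = D" if "C \<in> \<C>" "D \<in> \<C>" "v \<in> C" "v \<in> D" for C D v
    using \<C>(3)[OF that(1,2)] that by blast
  have C_ne: "C \<noteq> UNIV" if C: "C \<in> \<C>" for C
  proof
    assume "C = UNIV"
    then have "D = C" if "D \<in> \<C>" for D using uniq[OF that C] \<C>(2)[OF that] by blast
    then have "\<C> \<subseteq> {C}" by blast
    then show False using card_mono[of "{C}" \<C>] two by simp
  qed
  have "8 * card \<C> = (\<Sum>C\<in>\<C>. 8)" by simp
  also have "\<dots> \<le> (\<Sum>C\<in>\<C>. card {e \<in> ?X. e \<inter> C \<noteq> {}})"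
  proof (rule sum_mono)
    fix C assume C: "C \<in> \<C>"
    have "8 \<le> card (cut E C (- C))"
      using conn[unfolded mixed_connected_def, rule_format, of C "{}"] \<C>(2)[OF C] C_ne[OF C] by simp
    also have "\<dots> \<le> card {e \<in> ?X. e \<inter> C \<noteq> {}}"
    proof (rule card_mono)
      show "cut E C (- C) \<subseteq> {e \<in> ?X. e \<inter> C \<noteq> {}}"
        using uniq[OF C] by (fastforce simp: cut_def)
    qed simp
    finally show "8 \<le> card {e \<in> ?X. e \<inter> C \<noteq> {}}" .
  qed
  also have "\<dots> = (\<Sum>e\<in>?X. card {C \<in> \<C>. e \<inter> C \<noteq> {}})"
    by (rule sum_card_swap) auto
  also have "\<dots> \<le> (\<Sum>e\<in>?X. 2)"
  proof (rule sum_mono)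
    fix e assume "e \<in> ?X"
    then obtain u v where e: "e = {u, v}" using E by (metis (no_types, lifting) card_2_iff mem_Collect_eq)
    obtain C D where CD: "C \<in> \<C>" "u \<in> C" "D \<in> \<C>" "v \<in> D" using \<C>(1) by (metis UNIV_I UnionE)
    then have "{C \<in> \<C>. e \<inter> C \<noteq> {}} \<subseteq> {C, D}" using uniq e by auto
    then have "card {C \<in> \<C>. e \<inter> C \<noteq> {}} \<le> card {C, D}" by (intro card_mono) auto
    also have "\<dots> \<le> 2" by (simp add: card_insert_if)
    finally show "card {C \<in> \<C>. e \<inter> C \<noteq> {}} \<le> 2" .
  qed
  finally show ?thesis by simp
qed

text \<open>Discharging: doubling the inequality, every block \<open>X\<close> has \<open>8 * (2 * card X - 3)\<close> units, and every
  edge outside the blocks gives 3 units to each endpoint. A block pays 16 to each vertex that lies in no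
  other block and 8 to each other vertex. If \<open>b\<close> of its vertices are shared, at least \<open>8 - 2 * b\<close>
  edges outside the blocks leave its unshared part, which covers the deficit \<open>24 - 8 * b\<close>.\<close>

lemma blocks_and_free_edges_ge:
  fixes E :: "'v::finite set set"
  assumes E: "\<And>e. e \<in> E \<Longrightarrow> card e = 2" and conn: "mixed_connected E"
    and \<X>: "\<And>X. X \<in> \<X> \<Longrightarrow> 3 \<le> card X" "\<And>X. X \<in> \<X> \<Longrightarrow> X \<noteq> UNIV"
      "\<And>X Y. X \<in> \<X> \<Longrightarrow> Y \<in> \<X> \<Longrightarrow> X \<noteq> Y \<Longrightarrow> card (X \<inter> Y) \<le> 1"
    and two: "2 \<le> CARD('v)"
  shows "8 * CARD('v) \<le> 4 * (\<Sum>X\<in>\<X>. 2 * card X - 3) + 3 * card {e \<in> E. \<not> (\<exists>X\<in>\<X>. e \<subseteq> X)}"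
proof -
  define E' where "E' = {e \<in> E. \<not> (\<exists>X\<in>\<X>. e \<subseteq> X)}"
  define m where "m v = card {X \<in> \<X>. v \<in> X}" for v
  define d where "d v = card {e \<in> E'. v \<in> e}" for v
  define w :: "'v \<Rightarrow> nat" where "w v = (if m v = 1 then 16 else 8)" for v
  define V1 where "V1 = {v. m v = 1}"
  have only: "Y = X" if v: "v \<in> V1" "v \<in> X" "v \<in> Y" and XY: "X \<in> \<X>" "Y \<in> \<X>" for v X Y
  proof -
    obtain Z where "{X \<in> \<X>. v \<in> X} = {Z}"
      using v(1) unfolding V1_def m_def by (auto simp: card_1_singleton_iff)
    moreover have "X \<in> {X \<in> \<X>. v \<in> X}" "Y \<in> {X \<in> \<X>. v \<in> X}" using v XY by simp_all
    ultimately show ?thesis by simp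
  qed
  have sum_d: "(\<Sum>v\<in>UNIV. d v) = 2 * card E'"
  proof -
    have "(\<Sum>v\<in>UNIV. d v) = (\<Sum>e\<in>E'. card {v \<in> UNIV. v \<in> e})"
      unfolding d_def by (rule sum_card_swap) auto
    also have "\<dots> = (\<Sum>e\<in>E'. 2)" by (rule sum.cong) (auto simp: E'_def E)
    finally show ?thesis by simp
  qed
  have d_ge: "8 \<le> d v" if "m v = 0" for v
  proof -
    have nv: "v \<notin> X" if "X \<in> \<X>" for X
      using \<open>m v = 0\<close> that unfolding m_def by auto
    have "{v} \<noteq> (UNIV :: 'v set)"
    proof
      assume "{v} = (UNIV :: 'v set)"
      then have "CARD('v) = card {v}" by simp
      then show False using two by simp
    qed
    then have "8 \<le> card (cut E {v} (- {v}))"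
      using conn[unfolded mixed_connected_def, rule_format, of "{v}" "{}"] by simp
    also have "\<dots> \<le> d v" unfolding d_def
      by (rule card_mono) (use nv in \<open>auto simp: cut_def E'_def\<close>)
    finally show ?thesis .
  qed
  have block: "(\<Sum>v\<in>X. w v) \<le> 8 * (2 * card X - 3) + 3 * (\<Sum>v\<in>X \<inter> V1. d v)" if X: "X \<in> \<X>" for X
  proof -
    have cardX: "card X = card (X \<inter> V1) + card (X - V1)"
      by (metis Diff_Diff_Int Int_Diff add.commute card_Diff_subset_Int card_Int_Diff finite)
    have sum_w: "(\<Sum>v\<in>X. w v) = 16 * card (X \<inter> V1) + 8 * card (X - V1)"
    proof -
      have "(\<Sum>v\<in>X. w v) = (\<Sum>v\<in>X \<inter> V1. w v) + (\<Sum>v\<in>X - V1. w v)"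
        by (rule sum.Int_Diff) simp
      also have "(\<Sum>v\<in>X \<inter> V1. w v) = (\<Sum>v\<in>X \<inter> V1. 16)"
        by (rule sum.cong) (auto simp: w_def V1_def)
      also have "(\<Sum>v\<in>X - V1. w v) = (\<Sum>v\<in>X - V1. 8)"
        by (rule sum.cong) (auto simp: w_def V1_def)
      finally show ?thesis by simp
    qed
    \<comment> \<open>The shared vertices serve as the deleted set and the unshared ones as the side
      of the cut.\<close>
    have leave: "8 \<le> (\<Sum>v\<in>X \<inter> V1. d v) + 2 * card (X - V1)" if "X \<inter> V1 \<noteq> {}"
    proof -
      have "(X - V1) \<union> (X \<inter> V1) = X" by auto
      then have "8 \<le> card (cut E (X \<inter> V1) (- X)) + 2 * card (X - V1)"
        using conn[unfolded mixed_connected_def, rule_format, of "X \<inter> V1" "X - V1"] that \<X>(2)[OF X]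
        by auto
      also have "card (cut E (X \<inter> V1) (- X)) \<le> card (\<Union>v\<in>X \<inter> V1. {e \<in> E'. v \<in> e})"
      proof (rule card_mono)
        show "cut E (X \<inter> V1) (- X) \<subseteq> (\<Union>v\<in>X \<inter> V1. {e \<in> E'. v \<in> e})"
        proof
          fix e assume "e \<in> cut E (X \<inter> V1) (- X)"
          then obtain s t where e: "e \<in> E" "s \<in> X" "s \<in> V1" "t \<notin> X" "e = {s, t}"
            by (auto simp: cut_def)
          \<comment> \<open>The only block containing \<open>s\<close> is \<open>X\<close>, which
            misses \<open>t\<close>, so no block contains the edge.\<close>
          then have "e \<in> E'" using only[OF e(3,2) _ X] by (auto simp: E'_def)
          then show "e \<in> (\<Union>v\<in>X \<inter> V1. {e \<in> E'. v \<in> e})" using e by auto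
        qed
      qed simp
      also have "\<dots> \<le> (\<Sum>v\<in>X \<inter> V1. d v)" unfolding d_def by (rule card_UN_le) simp
      finally show ?thesis by simp
    qed
    show ?thesis
    proof (cases "X \<inter> V1 = {}")
      \<comment> \<open>With all vertices shared the block owes \<open>8 * card X\<close>, at most
        \<open>8 * (2 * card X - 3)\<close> because \<open>card X \<ge> 3\<close>.\<close>
      case True
      then show ?thesis using \<X>(1)[OF X] cardX sum_w by simp
    next
      case False
      then have "0 < card (X \<inter> V1)" by (simp add: card_gt_0_iff)
      then show ?thesis using leave[OF False] \<X>(1)[OF X] cardX sum_w by linarith
    qed
  qed
  have "16 * CARD('v) \<le> (\<Sum>v\<in>UNIV. m v * w v + (if m v = 0 then 3 * d v else 0))"
  proof -
    have "16 * CARD('v) = (\<Sum>v\<in>(UNIV :: 'v set). 16)" by simp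
    also have "\<dots> \<le> (\<Sum>v\<in>UNIV. m v * w v + (if m v = 0 then 3 * d v else 0))"
    proof (rule sum_mono)
      fix v
      consider "m v = 0" | "m v = 1" | "2 \<le> m v" by linarith
      then show "16 \<le> m v * w v + (if m v = 0 then 3 * d v else 0)"
        by cases (use d_ge[of v] in \<open>auto simp: w_def\<close>)
    qed
    finally show ?thesis .
  qed
  also have "\<dots> = (\<Sum>v\<in>UNIV. m v * w v) + 3 * (\<Sum>v | m v = 0. d v)"
    by (simp add: sum.distrib sum_distrib_left sum.If_cases)
  also have "(\<Sum>v\<in>UNIV. m v * w v) = (\<Sum>X\<in>\<X>. \<Sum>v\<in>X. w v)"
  proof -
    have "(\<Sum>v\<in>UNIV. m v * w v) = (\<Sum>v\<in>UNIV. \<Sum>X\<in>{X \<in> \<X>. v \<in> X}. w v)"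
      by (simp add: m_def)
    also have "\<dots> = (\<Sum>X\<in>\<X>. \<Sum>v\<in>{v \<in> UNIV. v \<in> X}. w v)"
      by (rule sum.swap_restrict) auto
    finally show ?thesis by simp
  qed
  also have "\<dots> \<le> (\<Sum>X\<in>\<X>. 8 * (2 * card X - 3) + 3 * (\<Sum>v\<in>X \<inter> V1. d v))"
    by (rule sum_mono[OF block])
  also have "\<dots> = 8 * (\<Sum>X\<in>\<X>. 2 * card X - 3) + 3 * (\<Sum>X\<in>\<X>. \<Sum>v\<in>X \<inter> V1. d v)"
    by (simp add: sum.distrib sum_distrib_left)
  \<comment> \<open>The unshared parts of different blocks are disjoint, so what a vertex receives
    from free edges is spent once.\<close>
  also have "(\<Sum>X\<in>\<X>. \<Sum>v\<in>X \<inter> V1. d v) = (\<Sum>v\<in>(\<Union>X\<in>\<X>. X \<inter> V1). d v)"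
    by (rule sum.UNION_disjoint[symmetric]) (simp_all, use only in blast)
  also have "\<dots> \<le> (\<Sum>v\<in>V1. d v)" by (rule sum_mono2) auto
  finally have "16 * CARD('v) \<le> 8 * (\<Sum>X\<in>\<X>. 2 * card X - 3) + 3 * ((\<Sum>v\<in>V1. d v) + (\<Sum>v | m v = 0. d v))"
    by simp
  also have "(\<Sum>v\<in>V1. d v) + (\<Sum>v | m v = 0. d v) = (\<Sum>v\<in>V1 \<union> {v. m v = 0}. d v)"
    by (rule sum.union_disjoint[symmetric]) (auto simp: V1_def)
  also have "\<dots> \<le> (\<Sum>v\<in>UNIV. d v)" by (rule sum_mono2) auto
  finally show ?thesis using sum_d unfolding E'_def by simp
qed

text \<open>The condition of \<open>matroid_intersection\<close> for the target
  \<open>2 * CARD('v) - 3\<close>, with the dual rank unfolded and \<open>sparse_rank 1 1 E\<close>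
  bounded by \<open>CARD('v) - 1\<close>. Each edge of \<open>E - F\<close> is split: three quarters
  pay for the planar rank through \<open>blocks_and_free_edges_ge\<close>, one quarter for the
  components of \<open>F\<close> through \<open>crossing_edges_ge\<close>.\<close>

lemma union_rank_ge:
  fixes E :: "'v::finite set set"
  assumes E: "\<And>e. e \<in> E \<Longrightarrow> card e = 2" and conn: "mixed_connected E"
    and two: "2 \<le> CARD('v)" and F: "F \<subseteq> E"
  shows "3 * CARD('v) \<le> 4 + sparse_rank 2 3 F + sparse_rank 1 1 F + card (E - F)"
proof -
  have F2: "card e = 2" if "e \<in> F" for e using that F E by blast
  obtain \<C> where \<C>: "\<And>X. X \<in> \<C> \<Longrightarrow> 1 \<le> 1 * card X"
    "\<And>X Y. X \<in> \<C> \<Longrightarrow> Y \<in> \<C> \<Longrightarrow> X \<noteq> Y \<Longrightarrow> 1 * card (X \<inter> Y) < 1"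
    "\<And>e. e \<in> F \<Longrightarrow> \<exists>X\<in>\<C>. e \<subseteq> X" "\<And>Y. 1 * card Y = 1 \<Longrightarrow> \<exists>X\<in>\<C>. Y \<subseteq> X"
    "sparse_rank 1 1 F = (\<Sum>X\<in>\<C>. 1 * card X - 1)"
    by (rule sparse_rank_blocks[of 1 1 F, OF _ F2]) auto
  obtain \<X> where \<X>: "\<And>X. X \<in> \<X> \<Longrightarrow> 3 \<le> 2 * card X"
    "\<And>X Y. X \<in> \<X> \<Longrightarrow> Y \<in> \<X> \<Longrightarrow> X \<noteq> Y \<Longrightarrow> 2 * card (X \<inter> Y) < 3"
    "\<And>e. e \<in> F \<Longrightarrow> \<exists>X\<in>\<X>. e \<subseteq> X" "sparse_rank 2 3 F = (\<Sum>X\<in>\<X>. 2 * card X - 3)"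
    by (rule sparse_rank_blocks[of 3 2 F, OF _ F2]) auto
  have \<C>': "\<Union>\<C> = UNIV" "\<And>C. C \<in> \<C> \<Longrightarrow> C \<noteq> {}"
      "\<And>C D. C \<in> \<C> \<Longrightarrow> D \<in> \<C> \<Longrightarrow> C \<noteq> D \<Longrightarrow> C \<inter> D = {}"
    using \<C>(4)[of "{_}"] \<C>(1,2) by fastforce+
  have "CARD('v) = (\<Sum>C\<in>\<C>. card C)"
    using card_Union_disjoint[of \<C>] \<C>' by (auto simp: pairwise_def disjnt_def)
  also have "\<dots> = (\<Sum>C\<in>\<C>. (card C - 1) + 1)"
    using \<C>(1) by (intro sum.cong) (simp_all add: Suc_le_eq)
  also have "\<dots> = sparse_rank 1 1 F + card \<C>" unfolding \<C>(5) sum.distrib by simp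
  finally have r1: "CARD('v) = sparse_rank 1 1 F + card \<C>" .
  have "\<C> \<noteq> {}" using \<C>'(1) by auto
  then have c: "1 \<le> card \<C>" by (simp add: Suc_le_eq card_gt_0_iff)
  have cross: "4 * card \<C> \<le> card (E - F)" if "2 \<le> card \<C>"
  proof -
    have "4 * card \<C> \<le> card {e \<in> E. \<not> (\<exists>C\<in>\<C>. e \<subseteq> C)}"
      by (rule crossing_edges_ge[OF E conn \<C>' that])
    also have "\<dots> \<le> card (E - F)" using \<C>(3) by (intro card_mono) auto
    finally show ?thesis .
  qed
  show ?thesis
  proof (cases "UNIV \<in> \<X>")
    case True
    then have "2 * CARD('v) - 3 \<le> sparse_rank 2 3 F"
      unfolding \<X>(4) by (intro member_le_sum) auto
    then show ?thesis using r1 c cross by (cases "2 \<le> card \<C>") linarith+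
  next
    case False
    \<comment> \<open>A two-vertex block contributes 1 to the rank, more than the 3/4 it costs as a
      free edge, so only larger blocks are kept as blocks.\<close>
    let ?B = "{X \<in> \<X>. 3 \<le> card X}" and ?S = "{X \<in> \<X>. card X = 2}"
    let ?E' = "{e \<in> E. \<not> (\<exists>X\<in>?B. e \<subseteq> X)}"
    have "8 * CARD('v) \<le> 4 * (\<Sum>X\<in>?B. 2 * card X - 3) + 3 * card ?E'"
      by (rule blocks_and_free_edges_ge[OF E conn _ _ _ two]) (use \<X>(2) False in fastforce)+
    moreover have "card ?E' \<le> card (E - F) + card ?S"
    proof -
      have "?E' \<subseteq> (E - F) \<union> ?S"
      proof
        fix e assume e: "e \<in> ?E'"
        show "e \<in> (E - F) \<union> ?S"
        proof (cases "e \<in> F")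
          case True
          then obtain X where X: "X \<in> \<X>" "e \<subseteq> X" using \<X>(3) by blast
          then have "\<not> 3 \<le> card X" using e by blast
          then have "card X = 2" using \<X>(1)[OF X(1)] by linarith
          then have "e = X" using F2[OF True] X(2) by (intro card_subset_eq) auto
          then show ?thesis using X \<open>card X = 2\<close> by blast
        qed (use e in blast)
      qed
      then have "card ?E' \<le> card ((E - F) \<union> ?S)" by (rule card_mono[rotated]) simp
      also have "\<dots> \<le> card (E - F) + card ?S" by (rule card_Un_le)
      finally show ?thesis .
    qed
    moreover have "sparse_rank 2 3 F = (\<Sum>X\<in>?B. 2 * card X - 3) + card ?S"
    proof -
      have "\<X> = ?B \<union> ?S" using \<X>(1) by force
      then have "sparse_rank 2 3 F = (\<Sum>X\<in>?B \<union> ?S. 2 * card X - 3)" using \<X>(4) by simp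
      also have "\<dots> = (\<Sum>X\<in>?B. 2 * card X - 3) + (\<Sum>X\<in>?S. 2 * card X - 3)"
        by (rule sum.union_disjoint) auto
      also have "(\<Sum>X\<in>?S. 2 * card X - 3) = (\<Sum>X\<in>?S. 1)" by (rule sum.cong) auto
      finally show ?thesis by simp
    qed
    ultimately show ?thesis using r1 c cross by (cases "2 \<le> card \<C>") linarith+
  qed
qed

lemma sparse_rank_le:
  fixes F :: "'v::finite set set"
  assumes "l \<le> k * CARD('v)"
  shows "sparse_rank k l F + l \<le> k * CARD('v)"
proof -
  obtain I where I: "I \<subseteq> F" "count_sparse k l I" "card I = sparse_rank k l F"
    using sparse_rank_attained by blast
  have "induced I UNIV = I" by (auto simp: induced_def)
  then show ?thesis using I assms unfolding count_sparse_def by metis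
qed

theorem packing_laman_and_tree:
  fixes E :: "'v::finite set set"
  assumes E: "\<And>e. e \<in> E \<Longrightarrow> card e = 2" and conn: "mixed_connected E" and two: "2 \<le> CARD('v)"
  obtains H T where "H \<subseteq> E" "T \<subseteq> E" "H \<inter> T = {}"
    "count_sparse 2 3 H" "card H + 3 = 2 * CARD('v)" "count_sparse 1 1 T" "card T + 1 = CARD('v)"
proof -
  let ?r = "\<lambda>A. int (sparse_rank 2 3 A)" and ?s = "\<lambda>A. int (sparse_rank 1 1 A)"
  let ?k = "2 * CARD('v) - 3"
  have s_le: "sparse_rank 1 1 E + 1 \<le> CARD('v)" and r_le: "sparse_rank 2 3 E + 3 \<le> 2 * CARD('v)"
    using sparse_rank_le[of 1 1 E] sparse_rank_le[of 3 2 E] two by auto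
  have rank: "rank_function E ?r" "rank_function E ?s"
    by (rule rank_function_sparse_rank; use E in simp)+
  have "\<exists>I\<subseteq>E. card I = ?k \<and> ?r I = int ?k \<and> int (card I) + ?s (E - I) - ?s E = int ?k"
  proof (rule matroid_intersection[OF _ rank(1) rank_function_dual[OF rank(2)]])
    fix A assume A: "A \<subseteq> E"
    then have "E - (E - A) = A" by auto
    then show "int ?k \<le> ?r A + (int (card (E - A)) + ?s (E - (E - A)) - ?s E)"
      using union_rank_ge[OF E conn two A] s_le by simp
  qed auto
  \<comment> \<open>Dual rank equal to cardinality says exactly that the complement of
    \<open>H\<close> keeps the full tree rank.\<close>
  then obtain H where H: "H \<subseteq> E" "card H = ?k" "?r H = int ?k" "?s (E - H) = ?s E" by auto
  obtain H' where H': "H' \<subseteq> H" "count_sparse 2 3 H'" "card H' = sparse_rank 2 3 H"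
    using sparse_rank_attained by blast
  have "H' = H" using H H' by (intro card_subset_eq) auto
  obtain T where T: "T \<subseteq> E - H" "count_sparse 1 1 T" "card T = sparse_rank 1 1 (E - H)"
    using sparse_rank_attained by blast
  \<comment> \<open>At \<open>F = E\<close> no edge is missing from the rank inequality, so both
    ranks attain their upper bounds.\<close>
  have "card T + 1 = CARD('v)"
    using T(3) H(4) union_rank_ge[OF E conn two order_refl] s_le r_le by simp
  then show thesis
    using H T H' \<open>H' = H\<close> two by (intro that[of H T]) auto
qed

section \<open>Infinitesimal rigidity in the plane\<close>

definition cross2 :: "real ^ 2 \<Rightarrow> real ^ 2 \<Rightarrow> real" where
  "cross2 p q = p $ 1 * q $ 2 - p $ 2 * q $ 1"

text \<open>The quarter turn: \<open>c *\<^sub>R rot z\<close> is the velocity of \<open>z\<close>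
  under a rotation about the origin.\<close>

definition rot :: "real ^ 2 \<Rightarrow> real ^ 2" where
  "rot z = vector [- z $ 2, z $ 1]"

lemma inner_plane: "(p :: real ^ 2) \<bullet> q = p $ 1 * q $ 1 + p $ 2 * q $ 2"
  by (simp add: inner_vec_def UNIV_2)

lemma rot_component [simp]: "rot z $ 1 = - z $ 2" "rot z $ 2 = z $ 1"
  by (simp_all add: rot_def)

lemma linear_rot: "linear rot"
  by (rule linearI) (simp_all add: vec_eq_iff forall_2)

lemma inner_rot_self: "z \<bullet> rot z = 0"
  by (simp add: inner_plane)

text \<open>Cramer's rule; \<open>cross2 p q\<close> is the determinant of the system.\<close>

lemma eq_0_if_orthogonal:
  assumes "p \<bullet> u = 0" "q \<bullet> u = 0" "cross2 p q \<noteq> 0"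
  shows "u = 0"
proof -
  have "cross2 p q * u $ 1 = (p \<bullet> u) * q $ 2 - (q \<bullet> u) * p $ 2"
    "cross2 p q * u $ 2 = (q \<bullet> u) * p $ 1 - (p \<bullet> u) * q $ 1"
    by (simp_all add: cross2_def inner_plane algebra_simps)
  then show ?thesis using assms by (simp add: vec_eq_iff forall_2)
qed

text \<open>Subtract the projection onto \<open>rot d\<close>: since
  \<open>rot d \<bullet> u = cross2 d u\<close>, the remainder is orthogonal to the basis
  \<open>d\<close>, \<open>rot d\<close>.\<close>

lemma orthogonal_multiple_rot:
  assumes "d \<bullet> u = 0" "d \<noteq> 0"
  shows "\<exists>c. u = c *\<^sub>R rot d"
proof -
  let ?u = "u - (cross2 d u / (d \<bullet> d)) *\<^sub>R rot d"
  have dd: "d \<bullet> d \<noteq> 0" using assms(2) by simp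
  have "cross2 d (rot d) = d \<bullet> d" by (simp add: cross2_def inner_plane)
  moreover have "rot d \<bullet> ?u = 0"
  proof -
    have "rot d \<bullet> u = cross2 d u" "rot d \<bullet> rot d = d \<bullet> d"
      by (simp_all add: cross2_def inner_plane)
    then show ?thesis using dd by (simp add: inner_diff_right)
  qed
  moreover have "d \<bullet> ?u = 0" using assms(1) by (simp add: inner_diff_right inner_rot_self)
  ultimately have "?u = 0" using dd by (intro eq_0_if_orthogonal[of d ?u "rot d"]) auto
  then show ?thesis by auto
qed

section \<open>Polynomial conditions tested along lines\<close>

definition polynomial_on_lines :: "('a::real_vector \<Rightarrow> real) \<Rightarrow> bool" where
  "polynomial_on_lines g \<longleftrightarrow> (\<forall>z d. \<exists>p. \<forall>t. g (z + t *\<^sub>R d) = poly p t)"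

lemma polynomial_on_lines_const: "polynomial_on_lines (\<lambda>z. c)"
  unfolding polynomial_on_lines_def by (auto intro: exI[of _ "[:c:]"])

lemma polynomial_on_lines_nth: "polynomial_on_lines (\<lambda>z :: real ^ 'n. z $ i)"
  unfolding polynomial_on_lines_def
proof (intro allI)
  fix z d :: "real ^ 'n"
  show "\<exists>p. \<forall>t. (z + t *\<^sub>R d) $ i = poly p t" by (rule exI[of _ "[:z $ i, d $ i:]"]) simp
qed

lemma polynomial_on_lines_add:
  "polynomial_on_lines f \<Longrightarrow> polynomial_on_lines g \<Longrightarrow> polynomial_on_lines (\<lambda>z. f z + g z)"
  unfolding polynomial_on_lines_def by (metis poly_add)

lemma polynomial_on_lines_diff:
  "polynomial_on_lines f \<Longrightarrow> polynomial_on_lines g \<Longrightarrow> polynomial_on_lines (\<lambda>z. f z - g z)"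
  unfolding polynomial_on_lines_def by (metis poly_diff)

lemma polynomial_on_lines_mult:
  "polynomial_on_lines f \<Longrightarrow> polynomial_on_lines g \<Longrightarrow> polynomial_on_lines (\<lambda>z. f z * g z)"
  unfolding polynomial_on_lines_def by (metis poly_mult)

lemmas polynomial_on_lines_intros = polynomial_on_lines_const polynomial_on_lines_nth
  polynomial_on_lines_add polynomial_on_lines_diff polynomial_on_lines_mult

text \<open>Genericity reduces to the roots of one univariate polynomial: a single nonzero value on
  a line leaves finitely many zeros there.\<close>

lemma finite_zeros_on_line:
  assumes "polynomial_on_lines g" "g (z + s *\<^sub>R d) \<noteq> 0"
  shows "finite {t. g (z + t *\<^sub>R d) = 0}"
proof -
  obtain p where p: "\<And>t. g (z + t *\<^sub>R d) = poly p t"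
    using assms(1) unfolding polynomial_on_lines_def by blast
  then have "p \<noteq> 0" using assms(2) by auto
  then show ?thesis using poly_roots_finite by (simp add: p)
qed

text \<open>Join a point where the earlier functions are nonzero to one where the new function is:
  every function has a nonzero value on this line, so finitely many parameters are bad.\<close>

lemma common_nonzero:
  fixes \<G> :: "('a::real_vector \<Rightarrow> real) set"
  assumes "finite \<G>" "\<And>g. g \<in> \<G> \<Longrightarrow> polynomial_on_lines g" "\<And>g. g \<in> \<G> \<Longrightarrow> \<exists>q. g q \<noteq> 0"
  shows "\<exists>q. \<forall>g\<in>\<G>. g q \<noteq> 0"
  using assms
proof (induction \<G> rule: finite_induct)
  case (insert g \<G>)
  then have "\<exists>q. \<forall>g\<in>\<G>. g q \<noteq> 0" "\<exists>r. g r \<noteq> 0" by simp_all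
  then obtain q r where q: "\<forall>g\<in>\<G>. g q \<noteq> 0" and r: "g r \<noteq> 0" by blast
  have "finite {t. g (q + t *\<^sub>R (r - q)) = 0}"
    by (rule finite_zeros_on_line[where s = 1]) (use insert.prems r in auto)
  moreover have "finite (\<Union>f\<in>\<G>. {t. f (q + t *\<^sub>R (r - q)) = 0})"
  proof (rule finite_UN_I[OF insert.hyps(1)])
    fix f assume "f \<in> \<G>"
    then show "finite {t. f (q + t *\<^sub>R (r - q)) = 0}"
      using insert.prems q by (intro finite_zeros_on_line[where s = 0]) auto
  qed
  ultimately obtain t where "t \<notin> {t. g (q + t *\<^sub>R (r - q)) = 0} \<union> (\<Union>f\<in>\<G>. {t. f (q + t *\<^sub>R (r - q)) = 0})"
    using ex_new_if_finite[OF infinite_UNIV_char_0] finite_UnI by meson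
  then show ?case by (intro exI[of _ "q + t *\<^sub>R (r - q)"]) auto
qed simp

lemma common_nonzero_near:
  fixes \<G> :: "('a::real_normed_vector \<Rightarrow> real) set"
  assumes "finite \<G>" "\<And>g. g \<in> \<G> \<Longrightarrow> polynomial_on_lines g" "\<And>g. g \<in> \<G> \<Longrightarrow> \<exists>q. g q \<noteq> 0"
    and "0 < \<epsilon>"
  shows "\<exists>z. norm (z - z0) < \<epsilon> \<and> (\<forall>g\<in>\<G>. g z \<noteq> 0)"
proof -
  obtain q where q: "\<forall>g\<in>\<G>. g q \<noteq> 0" using common_nonzero[OF assms(1-3)] by blast
  \<comment> \<open>Everything may vanish at \<open>z0\<close>, but not on the whole line towards
    \<open>q\<close>; small parameters stay close to \<open>z0\<close>. The \<open>+ 1\<close> below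
    guards against \<open>q = z0\<close>.\<close>
  let ?Z = "\<Union>f\<in>\<G>. {t. f (z0 + t *\<^sub>R (q - z0)) = 0}"
  have "finite ?Z"
  proof (rule finite_UN_I[OF assms(1)])
    fix f assume "f \<in> \<G>"
    then show "finite {t. f (z0 + t *\<^sub>R (q - z0)) = 0}"
      using assms(2) q by (intro finite_zeros_on_line[where s = 1]) auto
  qed
  moreover have "infinite {0<..<\<epsilon> / (norm (q - z0) + 1)}"
    using assms(4) by (intro infinite_Ioo) (simp add: add_nonneg_pos)
  ultimately have "infinite ({0<..<\<epsilon> / (norm (q - z0) + 1)} - ?Z)" by (rule Diff_infinite_finite)
  then have "{0<..<\<epsilon> / (norm (q - z0) + 1)} - ?Z \<noteq> {}" by (rule infinite_imp_nonempty)
  then obtain t where "t \<in> {0<..<\<epsilon> / (norm (q - z0) + 1)} - ?Z" by blast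
  then have t: "0 < t" "t < \<epsilon> / (norm (q - z0) + 1)" "t \<notin> ?Z" by simp_all
  have "t * norm (q - z0) \<le> t * (norm (q - z0) + 1)" using t(1) by simp
  also have "\<dots> < \<epsilon>" using t(2) by (simp add: pos_less_divide_eq add_nonneg_pos)
  finally show ?thesis using t by (intro exI[of _ "z0 + t *\<^sub>R (q - z0)"]) auto
qed

section \<open>Infinitesimal flexes and extensions by one vertex\<close>

definition flex :: "'v set set \<Rightarrow> ('v \<Rightarrow> real ^ 2) \<Rightarrow> ('v \<Rightarrow> real ^ 2) \<Rightarrow> bool" where
  "flex H x u \<longleftrightarrow> (\<forall>v w. {v, w} \<in> H \<longrightarrow> (x v - x w) \<bullet> (u v - u w) = 0)"

text \<open>An explicit \<open>S\<close> lets the induction remove vertices while the type stays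
  fixed; velocities outside \<open>S\<close> are left free.\<close>

definition plane_rigid :: "'v set \<Rightarrow> 'v set set \<Rightarrow> ('v \<Rightarrow> real ^ 2) \<Rightarrow> bool" where
  "plane_rigid S H x \<longleftrightarrow> (\<forall>u. flex H x u \<longrightarrow> (\<exists>c b. \<forall>v\<in>S. u v = c *\<^sub>R rot (x v) + b))"

text \<open>Distinct points, no three on a line; injectivity is separate because the second clause
  is void for two points.\<close>

definition general_position :: "'v set \<Rightarrow> ('v \<Rightarrow> real ^ 2) \<Rightarrow> bool" where
  "general_position S x \<longleftrightarrow> inj_on x S \<and>
     (\<forall>a\<in>S. \<forall>b\<in>S. \<forall>c\<in>S. a \<noteq> b \<longrightarrow> b \<noteq> c \<longrightarrow> a \<noteq> c \<longrightarrow> cross2 (x c - x a) (x c - x b) \<noteq> 0)"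

definition laman :: "'v::finite set \<Rightarrow> 'v set set \<Rightarrow> bool" where
  "laman S H \<longleftrightarrow> (\<forall>e\<in>H. e \<subseteq> S \<and> card e = 2) \<and> count_sparse 2 3 H \<and> card H + 3 = 2 * card S"

lemma flex_cong:
  assumes "flex H x u" "\<And>e. e \<in> H \<Longrightarrow> e \<subseteq> S" "\<And>v. v \<in> S \<Longrightarrow> x v = x' v"
  shows "flex H x' u"
  using assms unfolding flex_def by (metis insert_subset)

lemma flex_subset: "flex H x u \<Longrightarrow> H' \<subseteq> H \<Longrightarrow> flex H' x u"
  unfolding flex_def by blast

lemma general_position_insert:
  assumes "general_position S x" "v \<notin> S" "\<And>a. a \<in> S \<Longrightarrow> z \<noteq> x a"
    "\<And>a b. a \<in> S \<Longrightarrow> b \<in> S \<Longrightarrow> a \<noteq> b \<Longrightarrow> cross2 (z - x a) (z - x b) \<noteq> 0"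
  shows "general_position (insert v S) (x(v := z))"
proof -
  let ?x = "x(v := z)"
  \<comment> \<open>The orientation determinant is cyclic, so the new vertex can always be moved
    into the role of \<open>c\<close>.\<close>
  have cyc: "cross2 (?x c - ?x a) (?x c - ?x b) = cross2 (?x a - ?x b) (?x a - ?x c)" for a b c
    by (simp add: cross2_def algebra_simps)
  have "cross2 (?x c - ?x a) (?x c - ?x b) \<noteq> 0"
    if "a \<in> insert v S" "b \<in> insert v S" "c \<in> insert v S" "a \<noteq> b" "b \<noteq> c" "a \<noteq> c" for a b c
  proof -
    consider "c = v" | "a = v" | "b = v" | "a \<noteq> v" "b \<noteq> v" "c \<noteq> v" by blast
    then show ?thesis
    proof cases
      case 1 then show ?thesis using assms(4)[of a b] that by auto
    next
      case 2 then show ?thesis using assms(4)[of b c] that unfolding cyc[of c a b] by auto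
    next
      case 3 then show ?thesis using assms(4)[of c a] that unfolding cyc[of c a b] cyc[of a b c] by auto
    next
      case 4 then show ?thesis using assms(1) that by (auto simp: general_position_def)
    qed
  qed
  moreover have "inj_on ?x (insert v S)"
    using assms(1-3) by (auto simp: general_position_def inj_on_def)
  ultimately show ?thesis unfolding general_position_def by blast
qed

text \<open>The solvability condition for the velocity \<open>u\<close> of a new vertex at \<open>z\<close> in the three equations
  \<open>(z - xi) \<bullet> (u - wi) = 0\<close>.\<close>

definition ext_det :: "(real^2) \<Rightarrow> (real^2) \<Rightarrow> (real^2) \<Rightarrow> (real^2) \<Rightarrow> (real^2) \<Rightarrow> (real^2) \<Rightarrow> (real^2) \<Rightarrow> real" where
  "ext_det xa xb xc wa wb wc z = ((z - xa) \<bullet> wa) * cross2 (z - xb) (z - xc)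
     + ((z - xb) \<bullet> wb) * cross2 (z - xc) (z - xa) + ((z - xc) \<bullet> wc) * cross2 (z - xa) (z - xb)"

text \<open>Planar vectors satisfy \<open>cross2 q r *\<^sub>R p + cross2 r p *\<^sub>R q + cross2 p
  q *\<^sub>R r = 0\<close>; pair this relation with \<open>u\<close>.\<close>

lemma ext_det_eq_0:
  assumes "(z - xa) \<bullet> (u - wa) = 0" "(z - xb) \<bullet> (u - wb) = 0" "(z - xc) \<bullet> (u - wc) = 0"
  shows "ext_det xa xb xc wa wb wc z = 0"
proof -
  have "(z - xa) \<bullet> wa = (z - xa) \<bullet> u" "(z - xb) \<bullet> wb = (z - xb) \<bullet> u" "(z - xc) \<bullet> wc = (z - xc) \<bullet> u"
    using assms by (simp_all add: inner_diff_right)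
  then have "ext_det xa xb xc wa wb wc z = ((z - xa) \<bullet> u) * cross2 (z - xb) (z - xc)
     + ((z - xb) \<bullet> u) * cross2 (z - xc) (z - xa) + ((z - xc) \<bullet> u) * cross2 (z - xa) (z - xb)"
    by (simp only: ext_det_def)
  also have "\<dots> = 0"
    unfolding inner_plane cross2_def vector_minus_component by algebra
  finally show ?thesis .
qed

text \<open>The midpoint of the first two positions is a witness: there \<open>z - xa\<close> and \<open>z - xb\<close> are opposite.\<close>

lemma ext_det_nonzero:
  assumes "cross2 (xc - xa) (xc - xb) \<noteq> 0" "(xa - xb) \<bullet> (wa - wb) \<noteq> 0"
  shows "\<exists>z. ext_det xa xb xc wa wb wc z \<noteq> 0"
proof -
  define h where "h = (1 / 2) *\<^sub>R (xb - xa)"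
  define z where "z = xa + h"
  have x: "z - xa = h" "z - xb = - h" "xa - xb = - 2 *\<^sub>R h" "xc - xa = h - (z - xc)" "xc - xb = - h - (z - xc)"
    by (simp_all add: z_def h_def vec_eq_iff forall_2 field_simps)
  have 1: "cross2 (xc - xa) (xc - xb) = - 2 * cross2 h (z - xc)"
    unfolding x(4,5) by (simp add: cross2_def algebra_simps)
  \<comment> \<open>The term with \<open>cross2 h (- h)\<close> drops out, and the other two share
    the factor \<open>cross2 h (z - xc)\<close>.\<close>
  have "ext_det xa xb xc wa wb wc z = - (cross2 h (z - xc) * (h \<bullet> (wa - wb)))"
    unfolding ext_det_def x(1,2) inner_plane cross2_def vector_minus_component vector_uminus_component
    by algebra
  moreover have "h \<bullet> (wa - wb) \<noteq> 0" using assms(2) unfolding x(3) by simp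
  ultimately show ?thesis using assms(1) unfolding 1 by (intro exI[of _ z]) simp
qed

lemma polynomial_on_lines_ext_det: "polynomial_on_lines (ext_det xa xb xc wa wb wc)"
  unfolding ext_det_def[abs_def] inner_plane cross2_def vector_minus_component
  by (intro polynomial_on_lines_intros)

lemma polynomial_on_lines_cross2: "polynomial_on_lines (\<lambda>z. cross2 (z - p) (z - q))"
  unfolding cross2_def vector_minus_component by (intro polynomial_on_lines_intros)

lemma cross2_nonzero:
  assumes "p \<noteq> q"
  shows "\<exists>z. cross2 (z - p) (z - q) \<noteq> 0"
proof -
  \<comment> \<open>The witness leaves the line through \<open>p\<close> and \<open>q\<close> at a
    right angle in \<open>p\<close>.\<close>
  have "cross2 (rot (p - q) + p - p) (rot (p - q) + p - q) = - ((p - q) \<bullet> (p - q))"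
    by (simp add: cross2_def inner_plane algebra_simps)
  then show ?thesis using assms by (metis inner_eq_zero_iff neg_equal_0_iff_equal right_minus_eq)
qed

text \<open>Since \<open>rot (z - p)\<close> is orthogonal to \<open>z - p\<close>, the difference
  from the trivial motion at \<open>z\<close> is orthogonal to two independent directions.\<close>

lemma trivial_at_new_vertex:
  assumes "(z - xa) \<bullet> (u - (c *\<^sub>R rot xa + t)) = 0" "(z - xb) \<bullet> (u - (c *\<^sub>R rot xb + t)) = 0"
    and "cross2 (z - xa) (z - xb) \<noteq> 0"
  shows "u = c *\<^sub>R rot z + t"
proof -
  have "(z - p) \<bullet> (u - (c *\<^sub>R rot z + t)) = 0" if "(z - p) \<bullet> (u - (c *\<^sub>R rot p + t)) = 0" for p
  proof -
    have "u - (c *\<^sub>R rot z + t) = (u - (c *\<^sub>R rot p + t)) - c *\<^sub>R rot (z - p)"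
      by (simp add: linear_diff[OF linear_rot] algebra_simps)
    then have "(z - p) \<bullet> (u - (c *\<^sub>R rot z + t))
        = (z - p) \<bullet> (u - (c *\<^sub>R rot p + t)) - c * ((z - p) \<bullet> rot (z - p))"
      by (metis inner_diff_right inner_scaleR_right)
    then show ?thesis using that by (simp add: inner_rot_self)
  qed
  then have "u - (c *\<^sub>R rot z + t) = 0" using assms by (intro eq_0_if_orthogonal) auto
  then show ?thesis by simp
qed

text \<open>Henneberg's first move: the old velocities are trivial by rigidity, and the two new
  edges, having independent directions, determine the velocity of \<open>v\<close>.\<close>

lemma plane_rigid_0_extension:
  assumes rigid: "plane_rigid S H\<^sub>0 x" and H0: "\<And>e. e \<in> H\<^sub>0 \<Longrightarrow> e \<subseteq> S" and v: "v \<notin> S"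
    and ab: "a \<in> S" "b \<in> S" and z: "cross2 (z - x a) (z - x b) \<noteq> 0"
    and H: "H\<^sub>0 \<subseteq> H" "{v, a} \<in> H" "{v, b} \<in> H"
  shows "plane_rigid (insert v S) H (x(v := z))"
  unfolding plane_rigid_def
proof (intro allI impI)
  fix u assume u: "flex H (x(v := z)) u"
  have "flex H\<^sub>0 x u"
    by (rule flex_cong[OF flex_subset[OF u H(1)] H0]) (use v in auto)
  then obtain c t where S: "\<forall>i\<in>S. u i = c *\<^sub>R rot (x i) + t"
    using rigid unfolding plane_rigid_def by blast
  have "(z - x i) \<bullet> (u v - u i) = 0" if "{v, i} \<in> H" "i \<in> S" for i
    using u[unfolded flex_def, rule_format, OF that(1)] that(2) v by (auto split: if_splits)
  then have "u v = c *\<^sub>R rot z + t"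
    using z S ab H by (intro trivial_at_new_vertex[of z "x a" "u v" c t "x b"]) auto
  then show "\<exists>c t. \<forall>i\<in>insert v S. u i = c *\<^sub>R rot ((x(v := z)) i) + t"
    using S v by (intro exI[of _ c] exI[of _ t]) auto
qed

text \<open>Once \<open>{a, b}\<close> is removed, the flexes are spanned by the trivial ones and a single \<open>w\<close>; the three
  new edges leave no velocity for the new vertex that is compatible with \<open>w\<close> unless
  \<open>ext_det\<close> vanishes.\<close>

lemma plane_rigid_1_extension:
  assumes rigid: "plane_rigid S (insert {a, b} H\<^sub>0) x" and H0: "\<And>e. e \<in> H\<^sub>0 \<Longrightarrow> e \<subseteq> S" and v: "v \<notin> S"
    and abc: "a \<in> S" "b \<in> S" "c \<in> S" and z: "cross2 (z - x a) (z - x b) \<noteq> 0"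
    and w: "flex H\<^sub>0 x w" "(x a - x b) \<bullet> (w a - w b) \<noteq> 0"
    and det: "ext_det (x a) (x b) (x c) (w a) (w b) (w c) z \<noteq> 0"
    and H: "H\<^sub>0 \<subseteq> H" "{v, a} \<in> H" "{v, b} \<in> H" "{v, c} \<in> H"
  shows "plane_rigid (insert v S) H (x(v := z))"
  unfolding plane_rigid_def
proof (intro allI impI)
  fix u assume u: "flex H (x(v := z)) u"
  have u0: "flex H\<^sub>0 x u"
    by (rule flex_cong[OF flex_subset[OF u H(1)] H0]) (use v in auto)
  have uv: "(z - x i) \<bullet> (u v - u i) = 0" if "{v, i} \<in> H" "i \<in> S" for i
    using u[unfolded flex_def, rule_format, OF that(1)] that(2) v by (auto split: if_splits)
  \<comment> \<open>The multiple of \<open>w\<close> whose subtraction makes \<open>u\<close>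
    respect the absent edge \<open>{a, b}\<close> too.\<close>
  define s where "s = ((x a - x b) \<bullet> (u a - u b)) / ((x a - x b) \<bullet> (w a - w b))"
  define u' where "u' i = u i - s *\<^sub>R w i" for i
  have diff_u': "(x p - x q) \<bullet> (u' p - u' q) = (x p - x q) \<bullet> (u p - u q) - s * ((x p - x q) \<bullet> (w p - w q))" for p q
    by (simp add: u'_def inner_diff_right inner_diff_left algebra_simps)
  have ab0: "(x a - x b) \<bullet> (u' a - u' b) = 0"
    unfolding diff_u' s_def using w(2) by simp
  have "flex (insert {a, b} H\<^sub>0) x u'"
    unfolding flex_def
  proof (intro allI impI)
    fix p q assume "{p, q} \<in> insert {a, b} H\<^sub>0"
    then consider "{p, q} \<in> H\<^sub>0" | "p = a" "q = b" | "p = b" "q = a" by (auto simp: doubleton_eq_iff)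
    then show "(x p - x q) \<bullet> (u' p - u' q) = 0"
    proof cases
      case 1 then show ?thesis using u0 w(1) unfolding diff_u' flex_def by simp
    next
      case 3
      have "(x b - x a) \<bullet> (u' b - u' a) = (x a - x b) \<bullet> (u' a - u' b)"
        by (simp add: inner_diff_right inner_diff_left)
      then show ?thesis using 3 ab0 by simp
    qed (use ab0 in simp)
  qed
  then obtain r t where S: "\<forall>i\<in>S. u' i = r *\<^sub>R rot (x i) + t"
    using rigid unfolding plane_rigid_def by blast
  have "s = 0"
  proof (rule ccontr)
    assume s: "s \<noteq> 0"
    \<comment> \<open>Removing the trivial part and rescaling gives the new vertex a velocity
      compatible with \<open>w\<close> along all three edges.\<close>
    let ?y = "(1 / s) *\<^sub>R (u v - (r *\<^sub>R rot z + t))"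
    have "(z - x i) \<bullet> (?y - w i) = 0" if "{v, i} \<in> H" "i \<in> S" for i
    proof -
      have "u i = s *\<^sub>R w i + u' i" by (simp add: u'_def)
      then have "u i = s *\<^sub>R w i + (r *\<^sub>R rot (x i) + t)" using S that(2) by simp
      then have "s *\<^sub>R (?y - w i) = (u v - u i) - r *\<^sub>R rot (z - x i)"
        using s by (simp add: linear_diff[OF linear_rot] algebra_simps)
      then have "s * ((z - x i) \<bullet> (?y - w i)) = (z - x i) \<bullet> (u v - u i) - r * ((z - x i) \<bullet> rot (z - x i))"
        by (metis inner_diff_right inner_scaleR_right)
      then show ?thesis using uv[OF that] s by (simp add: inner_rot_self)
    qed
    then have "ext_det (x a) (x b) (x c) (w a) (w b) (w c) z = 0"
      using abc H by (intro ext_det_eq_0) auto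
    then show False using det by simp
  qed
  then have S: "\<forall>i\<in>S. u i = r *\<^sub>R rot (x i) + t" using S by (simp add: u'_def)
  then have "u v = r *\<^sub>R rot z + t"
    using z abc H uv by (intro trivial_at_new_vertex[of z "x a" "u v" r t "x b"]) auto
  then show "\<exists>c t. \<forall>i\<in>insert v S. u i = c *\<^sub>R rot ((x(v := z)) i) + t"
    using S v by (intro exI[of _ r] exI[of _ t]) auto
qed

section \<open>Laman graphs under vertex removal\<close>

lemma count_sparse_2_3_small:
  fixes F :: "'v::finite set set"
  assumes "\<And>e. e \<in> F \<Longrightarrow> card e = 2" "card F \<le> 3"
  shows "count_sparse 2 3 F"
  unfolding count_sparse_def
proof (intro allI impI)
  fix X :: "'v set" assume "3 \<le> 2 * card X"
  then consider "card X = 2" | "3 \<le> card X" by linarith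
  then show "card (induced F X) + 3 \<le> 2 * card X"
  proof cases
    case 1
    have "e = X" if "e \<in> induced F X" for e
      using that assms(1)[of e] 1 by (intro card_subset_eq) (auto simp: induced_def)
    then have "card (induced F X) \<le> card {X}" by (intro card_mono) auto
    then show ?thesis using 1 by simp
  next
    case 2
    have "card (induced F X) \<le> card F" by (rule card_mono) (auto simp: induced_def)
    then show ?thesis using 2 assms(2) by simp
  qed
qed

text \<open>Otherwise the triangle lies in the closure of \<open>H\<^sub>0\<close>, so its span with \<open>v\<close>, which has rank at most 5,
  raises the rank of \<open>H\<^sub>0\<close> by at most \<open>5 - 3\<close>, although three independent edges at \<open>v\<close> are added.\<close>

lemma laman_edge_reduction:
  fixes H\<^sub>0 :: "'v::finite set set"
  assumes H0: "\<And>e. e \<in> H\<^sub>0 \<Longrightarrow> card e = 2 \<and> v \<notin> e"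
    and distinct: "a \<noteq> b" "b \<noteq> c" "a \<noteq> c" "a \<noteq> v" "b \<noteq> v" "c \<noteq> v"
    and sparse: "count_sparse 2 3 (H\<^sub>0 \<union> {{v, a}, {v, b}, {v, c}})"
  shows "\<exists>e\<in>{{a, b}, {b, c}, {a, c}}. e \<notin> H\<^sub>0 \<and> count_sparse 2 3 (insert e H\<^sub>0)"
proof (rule ccontr)
  assume no: "\<not> ?thesis"
  let ?\<Delta> = "{{a, b}, {b, c}, {a, c}}" and ?star = "{{v, a}, {v, b}, {v, c}}"
  let ?r = "sparse_rank 2 3 :: 'v set set \<Rightarrow> nat"
  define F where "F = H\<^sub>0 \<union> ?\<Delta>"
  have F2: "card e = 2" if "e \<in> F" for e using that H0 distinct by (auto simp: F_def)
  have card_\<Delta>: "card ?\<Delta> = 3" using distinct by (simp add: doubleton_eq_iff card_insert_if)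
  have card_star: "card ?star = 3" using distinct by (simp add: doubleton_eq_iff card_insert_if)
  have "count_sparse 2 3 H\<^sub>0" by (rule count_sparse_subset[OF sparse]) auto
  \<comment> \<open>As none of the three edges can be added, \<open>H\<^sub>0\<close> is maximal
    sparse in \<open>F\<close>.\<close>
  then have rF: "?r F = card H\<^sub>0"
    using no F2 by (intro maximal_sparse_card[symmetric]) (auto simp: F_def)
  define K where "K = ?\<Delta> \<union> ?star"
  have "?r K \<le> 5"
  proof -
    obtain J where J: "J \<subseteq> K" "count_sparse 2 3 J" "card J = ?r K"
      using sparse_rank_attained by blast
    have "card {a, b, c, v} = 4" using distinct by simp
    then have "card J \<le> (\<Sum>X\<in>{{a, b, c, v}}. 2 * card X - 3)"
      using J(1) by (intro sparse_card_le_blocks[OF J(2)]) (auto simp: K_def)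
    also have "\<dots> = 5" using \<open>card {a, b, c, v} = 4\<close> by simp
    finally show ?thesis using J(3) by simp
  qed
  moreover have "3 \<le> ?r (F \<inter> K)"
  proof -
    have "count_sparse 2 3 ?\<Delta>"
      by (rule count_sparse_2_3_small) (use card_\<Delta> distinct in auto)
    then have "card ?\<Delta> \<le> ?r (F \<inter> K)"
      by (rule sparse_rank_ge[rotated]) (auto simp: F_def K_def)
    then show ?thesis using card_\<Delta> by simp
  qed
  moreover have "card H\<^sub>0 + 3 \<le> ?r (F \<union> K)"
  proof -
    have "H\<^sub>0 \<inter> ?star = {}" using H0 by auto
    then have "card (H\<^sub>0 \<union> ?star) = card H\<^sub>0 + 3" using card_star by (subst card_Un_disjoint) auto
    moreover have "card (H\<^sub>0 \<union> ?star) \<le> ?r (F \<union> K)"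
      by (rule sparse_rank_ge[OF _ sparse]) (auto simp: F_def K_def)
    ultimately show ?thesis by simp
  qed
  moreover have "?r (F \<union> K) + ?r (F \<inter> K) \<le> ?r F + ?r K"
  proof -
    have "rank_function (F \<union> K) (\<lambda>F. int (?r F))"
      by (rule rank_function_sparse_rank) (use F2 distinct in \<open>auto simp: K_def\<close>)
    from rank_function_submodular[OF this, of F "K"] show ?thesis by simp
  qed
  \<comment> \<open>Submodularity yields
    \<open>(card H\<^sub>0 + 3) + 3 \<le> card H\<^sub>0 + 5\<close>.\<close>
  ultimately show False using rF by linarith
qed

text \<open>Without \<open>v\<close> at most \<open>2 * (card S - 1) - 3\<close> edges remain, so
  every degree is at least 2; the degrees sum to \<open>4 * card S - 6\<close>, so some degree is
  below 4.\<close>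

lemma laman_degree:
  fixes S :: "'v::finite set"
  assumes lam: "laman S H" and S: "3 \<le> card S"
  obtains v where "v \<in> S" "card {e \<in> H. v \<in> e} = 2 \<or> card {e \<in> H. v \<in> e} = 3"
proof -
  let ?d = "\<lambda>v. card {e \<in> H. v \<in> e}"
  have H: "\<And>e. e \<in> H \<Longrightarrow> e \<subseteq> S \<and> card e = 2" "count_sparse 2 3 H" "card H + 3 = 2 * card S"
    using lam by (auto simp: laman_def)
  have ge: "2 \<le> ?d v" if v: "v \<in> S" for v
  proof -
    have "card (S - {v}) = card S - 1" using v by simp
    then have "card (induced H (S - {v})) + 3 \<le> 2 * (card S - 1)"
      using H(2)[unfolded count_sparse_def, rule_format, of "S - {v}"] S by simp
    moreover have "H = induced H (S - {v}) \<union> {e \<in> H. v \<in> e}" using H(1) by (fastforce simp: induced_def)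
    then have "card H \<le> card (induced H (S - {v})) + ?d v" by (metis card_Un_le)
    ultimately show ?thesis using H(3) by linarith
  qed
  have "\<exists>v\<in>S. ?d v < 4"
  proof (rule ccontr)
    assume "\<not> ?thesis"
    then have "(\<Sum>v\<in>S. 4) \<le> (\<Sum>v\<in>S. ?d v)" by (intro sum_mono) force
    also have "\<dots> = (\<Sum>e\<in>H. card {v \<in> S. v \<in> e})" by (rule sum_card_swap) auto
    also have "\<dots> = (\<Sum>e\<in>H. 2)"
    proof (rule sum.cong)
      fix e assume "e \<in> H"
      then have "{v \<in> S. v \<in> e} = e" using H(1) by auto
      then show "card {v \<in> S. v \<in> e} = 2" using H(1) \<open>e \<in> H\<close> by simp
    qed simp
    finally show False using H(3) S by simp
  qed
  then obtain v where "v \<in> S" "?d v < 4" by blast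
  with ge[of v] have "?d v = 2 \<or> ?d v = 3" by linarith
  then show thesis using \<open>v \<in> S\<close> that by blast
qed

text \<open>The Henneberg moves read backwards. At degree 2 the edge count drops as it should; at
  degree 3 one edge too many is lost, and \<open>laman_edge_reduction\<close> puts one back between
  two neighbours of \<open>v\<close>.\<close>

lemma laman_remove_vertex:
  fixes S :: "'v::finite set"
  assumes lam: "laman S H" and S: "3 \<le> card S"
  obtains (extension0) v a b H\<^sub>0 where "v \<in> S" "a \<in> S - {v}" "b \<in> S - {v}" "a \<noteq> b"
      "H\<^sub>0 \<subseteq> H" "{v, a} \<in> H" "{v, b} \<in> H" "laman (S - {v}) H\<^sub>0"
  | (extension1) v a b c H\<^sub>0 where "v \<in> S" "a \<in> S - {v}" "b \<in> S - {v}" "c \<in> S - {v}" "a \<noteq> b" "b \<noteq> c" "a \<noteq> c"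
      "H\<^sub>0 \<subseteq> H" "{v, a} \<in> H" "{v, b} \<in> H" "{v, c} \<in> H" "laman (S - {v}) (insert {a, b} H\<^sub>0)"
proof -
  have H: "\<And>e. e \<in> H \<Longrightarrow> e \<subseteq> S \<and> card e = 2" "count_sparse 2 3 H" "card H + 3 = 2 * card S"
    using lam by (auto simp: laman_def)
  obtain v where v: "v \<in> S" "card {e \<in> H. v \<in> e} = 2 \<or> card {e \<in> H. v \<in> e} = 3"
    using laman_degree[OF lam S] .
  define star where "star = {e \<in> H. v \<in> e}"
  define H\<^sub>0 where "H\<^sub>0 = H - star"
  define N where "N = {a. {v, a} \<in> H}"
  have star_N: "star = (\<lambda>a. {v, a}) ` N"
  proof
    show "star \<subseteq> (\<lambda>a. {v, a}) ` N"
    proof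
      fix e assume "e \<in> star"
      then have "e \<in> H" "v \<in> e" by (auto simp: star_def)
      then obtain a where "e = {v, a}" using H(1)[of e] by (auto simp: card_2_iff)
      then show "e \<in> (\<lambda>a. {v, a}) ` N" using \<open>e \<in> H\<close> by (auto simp: N_def)
    qed
  qed (auto simp: star_def N_def)
  have N: "N \<subseteq> S - {v}"
  proof
    fix a assume "a \<in> N"
    then have "{v, a} \<in> H" by (simp add: N_def)
    then show "a \<in> S - {v}" using H(1)[of "{v, a}"] by (cases "a = v") auto
  qed
  have "inj_on (\<lambda>a. {v, a}) N" by (auto simp: inj_on_def doubleton_eq_iff)
  then have card_N: "card N = card star" unfolding star_N by (simp add: card_image)
  have card_H: "card H = card H\<^sub>0 + card star"
    unfolding H\<^sub>0_def using card_Diff_subset[of star H] card_mono[of H star] by (auto simp: star_def)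
  have H0: "e \<subseteq> S - {v}" "card e = 2" if "e \<in> H\<^sub>0" for e
    using that H(1)[of e] by (auto simp: H\<^sub>0_def star_def)
  have card_S: "card (S - {v}) + 1 = card S" using v(1) S by simp
  consider "card star = 2" | "card star = 3" using v(2) by (auto simp: star_def)
  then show thesis
  proof cases
    case 1
    then have "card N = 2" using card_N by simp
    then obtain a b where ab: "N = {a, b}" "a \<noteq> b" by (auto simp: card_2_iff)
    have "laman (S - {v}) H\<^sub>0"
      unfolding laman_def using H0 H(3) 1 card_H card_S count_sparse_subset[OF H(2), of H\<^sub>0]
      by (auto simp: H\<^sub>0_def)
    moreover have "{v, a} \<in> H" "{v, b} \<in> H" using ab(1) by (auto simp: N_def)
    ultimately show thesis using v(1) ab N by (intro extension0[of v a b H\<^sub>0]) (auto simp: H\<^sub>0_def)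
  next
    case 2
    then have "card N = 3" using card_N by simp
    then obtain a b c where abc: "N = {a, b, c}" "a \<noteq> b" "b \<noteq> c" "a \<noteq> c"
      by (auto simp: card_3_iff)
    have "H = H\<^sub>0 \<union> {{v, a}, {v, b}, {v, c}}"
      using star_N unfolding abc(1) H\<^sub>0_def by (auto simp: star_def)
    then have "\<exists>e\<in>{{a, b}, {b, c}, {a, c}}. e \<notin> H\<^sub>0 \<and> count_sparse 2 3 (insert e H\<^sub>0)"
      using H0 H(2) abc N by (intro laman_edge_reduction[of _ v]) auto
    then obtain p q r where pqr: "N = {p, q, r}" "p \<noteq> q" "q \<noteq> r" "p \<noteq> r"
        "{p, q} \<notin> H\<^sub>0" "count_sparse 2 3 (insert {p, q} H\<^sub>0)"
    proof -
      assume *: "\<And>p q r. N = {p, q, r} \<Longrightarrow> p \<noteq> q \<Longrightarrow> q \<noteq> r \<Longrightarrow> p \<noteq> r \<Longrightarrow> {p, q} \<notin> H\<^sub>0 \<Longrightarrow>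
        count_sparse 2 3 (insert {p, q} H\<^sub>0) \<Longrightarrow> thesis"
      have perm: "N = {b, c, a}" "N = {a, c, b}" using abc(1) by auto
      assume "\<exists>e\<in>{{a, b}, {b, c}, {a, c}}. e \<notin> H\<^sub>0 \<and> count_sparse 2 3 (insert e H\<^sub>0)"
      then show thesis using *[OF abc] *[OF perm(1)] *[OF perm(2)] abc(2-4) by blast
    qed
    have "laman (S - {v}) (insert {p, q} H\<^sub>0)"
      unfolding laman_def using H0 H(3) 2 card_H card_S pqr N by auto
    moreover have "{v, p} \<in> H" "{v, q} \<in> H" "{v, r} \<in> H" using pqr(1) by (auto simp: N_def)
    ultimately show thesis using v(1) pqr N by (intro extension1[of v p q r H\<^sub>0]) (auto simp: H\<^sub>0_def)
  qed
qed

lemma plane_rigid_edge: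
  assumes "x a \<noteq> x b"
  shows "plane_rigid {a, b} {{a, b}} x"
  unfolding plane_rigid_def
proof (intro allI impI)
  fix u assume "flex {{a, b}} x u"
  then have "(x a - x b) \<bullet> (u a - u b) = 0" by (auto simp: flex_def)
  then obtain c where c: "u a - u b = c *\<^sub>R rot (x a - x b)"
    using orthogonal_multiple_rot[of "x a - x b"] assms by auto
  then have "u a = c *\<^sub>R rot (x a) + (u b - c *\<^sub>R rot (x b))"
    by (simp add: linear_diff[OF linear_rot] algebra_simps)
  then show "\<exists>c t. \<forall>v\<in>{a, b}. u v = c *\<^sub>R rot (x v) + t"
    by (intro exI[of _ c] exI[of _ "u b - c *\<^sub>R rot (x b)"]) auto
qed

text \<open>Closeness to an arbitrary \<open>x0\<close> allows a placement that is already
  prescribed up to \<epsilon> by the tree; general position is carried along because each extension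
  needs it.\<close>

theorem laman_rigid_dense:
  fixes S :: "'v::finite set"
  assumes "laman S H" "2 \<le> card S" "0 < \<epsilon>"
  shows "\<exists>x. (\<forall>v. norm (x v - x0 v) < \<epsilon>) \<and> general_position S x \<and> plane_rigid S H x"
  using assms
proof (induction "card S" arbitrary: S H rule: less_induct)
  case less
  show ?case
  proof (cases "card S = 2")
    case True
    then obtain a b where ab: "S = {a, b}" "a \<noteq> b" by (auto simp: card_2_iff)
    have "card H = 1" using less.prems(1) True by (simp add: laman_def)
    then obtain e where "H = {e}" by (auto simp: card_1_singleton_iff)
    moreover from this have "e = S"
      using less.prems(1) True by (intro card_subset_eq) (auto simp: laman_def)
    ultimately have H: "H = {{a, b}}" using ab by simp
    \<comment> \<open>A polynomial condition that forces \<open>z \<noteq> x0 b\<close>.\<close>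
    let ?g = "\<lambda>z :: real ^ 2. z $ 1 - x0 b $ 1"
    have "?g (x0 b + axis 1 1) \<noteq> 0" by simp
    then have "\<exists>z. ?g z \<noteq> 0" by blast
    moreover have "polynomial_on_lines ?g" by (intro polynomial_on_lines_intros)
    ultimately have "\<exists>z. norm (z - x0 a) < \<epsilon> \<and> (\<forall>g\<in>{?g}. g z \<noteq> 0)"
      using less.prems(3) by (intro common_nonzero_near) auto
    then obtain z where z: "norm (z - x0 a) < \<epsilon>" "z \<noteq> x0 b" by auto
    then show ?thesis
      using ab less.prems(3) plane_rigid_edge[of "x0(a := z)" a b]
      by (intro exI[of _ "x0(a := z)"]) (auto simp: H general_position_def)
  next
    case False
    then have S3: "3 \<le> card S" using less.prems(2) by simp
    let ?G = "\<lambda>v x. (\<lambda>(p, q) z. cross2 (z - x p) (z - x q)) ` {(p, q). p \<in> S - {v} \<and> q \<in> S - {v} \<and> p \<noteq> q}"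
    have step: "\<exists>x. (\<forall>v. norm (x v - x0 v) < \<epsilon>) \<and> general_position S x \<and> plane_rigid S H x"
      if v: "v \<in> S" and x: "\<forall>v. norm (x v - x0 v) < \<epsilon>" "general_position (S - {v}) x"
        and g: "polynomial_on_lines g" "\<exists>z. g z \<noteq> 0"
        and rigid: "\<And>z. g z \<noteq> 0 \<Longrightarrow> (\<And>p q. p \<in> S - {v} \<Longrightarrow> q \<in> S - {v} \<Longrightarrow> p \<noteq> q \<Longrightarrow> cross2 (z - x p) (z - x q) \<noteq> 0)
          \<Longrightarrow> plane_rigid (insert v (S - {v})) H (x(v := z))"
      for v x g
    proof -
      have fin: "finite {(p, q). p \<in> S - {v} \<and> q \<in> S - {v} \<and> p \<noteq> q}" by (rule finite)
      have "\<exists>z. norm (z - x0 v) < \<epsilon> \<and> (\<forall>g\<in>insert g (?G v x). g z \<noteq> 0)"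
      proof (rule common_nonzero_near)
        show "finite (insert g (?G v x))" using fin by simp
        show "polynomial_on_lines f" if "f \<in> insert g (?G v x)" for f
          using that g(1) by (auto intro: polynomial_on_lines_cross2)
        show "\<exists>z. f z \<noteq> 0" if "f \<in> insert g (?G v x)" for f
          using that g(2) x(2) by (auto intro!: cross2_nonzero simp: general_position_def inj_on_def)
      qed (rule less.prems(3))
      then obtain z where z: "norm (z - x0 v) < \<epsilon>" "g z \<noteq> 0" "\<forall>f\<in>?G v x. f z \<noteq> 0" by blast
      have cr: "cross2 (z - x p) (z - x q) \<noteq> 0" if "p \<in> S - {v}" "q \<in> S - {v}" "p \<noteq> q" for p q
        using z(3) that by fast
      have ne: "z \<noteq> x p" if "p \<in> S - {v}" for p
      proof
        assume "z = x p"
        \<comment> \<open>There is a third vertex \<open>q\<close>, and \<open>z = x p\<close> would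
          make the determinant for \<open>p\<close> and \<open>q\<close> vanish.\<close>
        have "card (S - {v, p}) \<noteq> 0" using v that S3 by (subst card_Diff_subset) auto
        then have "S - {v, p} \<noteq> {}" by auto
        then obtain q where "q \<in> S - {v}" "q \<noteq> p" by blast
        with cr[OF that this(1)] \<open>z = x p\<close> show False by (simp add: cross2_def)
      qed
      have "general_position (insert v (S - {v})) (x(v := z))"
        by (rule general_position_insert[OF x(2)]) (use ne cr in auto)
      moreover have "plane_rigid (insert v (S - {v})) H (x(v := z))" using rigid[OF z(2) cr] by simp
      moreover have "insert v (S - {v}) = S" using v by auto
      ultimately show ?thesis using x(1) z(1) by (intro exI[of _ "x(v := z)"]) auto
    qed
    show ?thesis
      using less.prems(1) S3
    proof (cases rule: laman_remove_vertex)
      case (extension0 v a b H\<^sub>0)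
      have cS: "card (S - {v}) < card S" "2 \<le> card (S - {v})" using extension0(1) S3 by auto
      obtain x where x: "\<forall>v. norm (x v - x0 v) < \<epsilon>" "general_position (S - {v}) x" "plane_rigid (S - {v}) H\<^sub>0 x"
        using less.hyps[OF cS(1) extension0(8) cS(2) less.prems(3)] by blast
      show ?thesis
      proof (rule step[OF extension0(1) x(1,2), of "\<lambda>z. 1"])
        fix z assume "\<And>p q. p \<in> S - {v} \<Longrightarrow> q \<in> S - {v} \<Longrightarrow> p \<noteq> q \<Longrightarrow> cross2 (z - x p) (z - x q) \<noteq> 0"
        then show "plane_rigid (insert v (S - {v})) H (x(v := z))"
          using extension0 by (intro plane_rigid_0_extension[OF x(3), of v a b z]) (auto simp: laman_def)
      qed (auto intro: polynomial_on_lines_const)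
    next
      case (extension1 v a b c H\<^sub>0)
      have cS: "card (S - {v}) < card S" "2 \<le> card (S - {v})" using extension1(1) S3 by auto
      obtain x where x: "\<forall>v. norm (x v - x0 v) < \<epsilon>" "general_position (S - {v}) x"
          "plane_rigid (S - {v}) (insert {a, b} H\<^sub>0) x"
        using less.hyps[OF cS(1) extension1(12) cS(2) less.prems(3)] by blast
      have sub: "\<And>e. e \<in> H\<^sub>0 \<Longrightarrow> e \<subseteq> S - {v}" using extension1(12) by (auto simp: laman_def)
      show ?thesis
      \<comment> \<open>This split replaces a dimension count: if every flex of
        \<open>H\<^sub>0\<close> respects \<open>{a, b}\<close>, then \<open>H\<^sub>0\<close> is
        itself rigid and a 0-extension suffices.\<close>
      proof (cases "\<exists>w. flex H\<^sub>0 x w \<and> (x a - x b) \<bullet> (w a - w b) \<noteq> 0")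
        case True
        then obtain w where w: "flex H\<^sub>0 x w" "(x a - x b) \<bullet> (w a - w b) \<noteq> 0" by blast
        show ?thesis
        proof (rule step[OF extension1(1) x(1,2) polynomial_on_lines_ext_det])
          show "\<exists>z. ext_det (x a) (x b) (x c) (w a) (w b) (w c) z \<noteq> 0"
            by (rule ext_det_nonzero[OF _ w(2)]) (use x(2) extension1 in \<open>auto simp: general_position_def\<close>)
        next
          fix z assume "ext_det (x a) (x b) (x c) (w a) (w b) (w c) z \<noteq> 0"
            "\<And>p q. p \<in> S - {v} \<Longrightarrow> q \<in> S - {v} \<Longrightarrow> p \<noteq> q \<Longrightarrow> cross2 (z - x p) (z - x q) \<noteq> 0"
          then show "plane_rigid (insert v (S - {v})) H (x(v := z))"
            using extension1 sub w by (intro plane_rigid_1_extension[OF x(3), of v c z w]) auto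
        qed
      next
        case False
        have "plane_rigid (S - {v}) H\<^sub>0 x"
          unfolding plane_rigid_def
        proof (intro allI impI)
          fix u assume u: "flex H\<^sub>0 x u"
          then have 1: "(x a - x b) \<bullet> (u a - u b) = 0" using False by blast
          have "(x b - x a) \<bullet> (u b - u a) = (x a - x b) \<bullet> (u a - u b)"
            by (simp add: inner_diff_right inner_diff_left)
          with 1 u have "flex (insert {a, b} H\<^sub>0) x u" by (auto simp: flex_def doubleton_eq_iff)
          then show "\<exists>c t. \<forall>v\<in>S - {v}. u v = c *\<^sub>R rot (x v) + t" using x(3) unfolding plane_rigid_def by blast
        qed
        note rigid0 = this
        show ?thesis
        proof (rule step[OF extension1(1) x(1,2), of "\<lambda>z. 1"])
          fix z assume "\<And>p q. p \<in> S - {v} \<Longrightarrow> q \<in> S - {v} \<Longrightarrow> p \<noteq> q \<Longrightarrow> cross2 (z - x p) (z - x q) \<noteq> 0"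
          then show "plane_rigid (insert v (S - {v})) H (x(v := z))"
            using extension1 sub by (intro plane_rigid_0_extension[OF rigid0, of v a b z]) auto
        qed (auto intro: polynomial_on_lines_const)
      qed
    qed
  qed
qed

section \<open>Light-like placements of trees\<close>

text \<open>Trees by counting, the form in which \<open>packing_laman_and_tree\<close> delivers
  them.\<close>

definition tree :: "'v::finite set \<Rightarrow> 'v set set \<Rightarrow> bool" where
  "tree S T \<longleftrightarrow> (\<forall>e\<in>T. e \<subseteq> S \<and> card e = 2) \<and> count_sparse 1 1 T \<and> card T + 1 = card S"

text \<open>All degrees are positive and sum to \<open>2 * card S - 2\<close>, so some degree is
  1.\<close>

lemma tree_remove_leaf:
  fixes S :: "'v::finite set"
  assumes tree: "tree S T" and S: "2 \<le> card S"
  obtains v w where "v \<in> S" "w \<in> S - {v}" "{e \<in> T. v \<in> e} = {{v, w}}" "tree (S - {v}) (T - {{v, w}})"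
proof -
  let ?d = "\<lambda>v. card {e \<in> T. v \<in> e}"
  have T: "\<And>e. e \<in> T \<Longrightarrow> e \<subseteq> S \<and> card e = 2" "count_sparse 1 1 T" "card T + 1 = card S"
    using tree by (auto simp: tree_def)
  have ge: "1 \<le> ?d v" if v: "v \<in> S" for v
  proof -
    have "card (induced T (S - {v})) + 1 \<le> card (S - {v})"
      using T(2)[unfolded count_sparse_def, rule_format, of "S - {v}"] S v by simp
    moreover have "T = induced T (S - {v}) \<union> {e \<in> T. v \<in> e}" using T(1) by (fastforce simp: induced_def)
    then have "card T \<le> card (induced T (S - {v})) + ?d v" by (metis card_Un_le)
    moreover have "card (S - {v}) + 1 = card S" using v S by simp
    ultimately show ?thesis using T(3) by linarith
  qed
  have "\<exists>v\<in>S. ?d v < 2"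
  proof (rule ccontr)
    assume "\<not> ?thesis"
    then have "(\<Sum>v\<in>S. 2) \<le> (\<Sum>v\<in>S. ?d v)" by (intro sum_mono) force
    also have "\<dots> = (\<Sum>e\<in>T. card {v \<in> S. v \<in> e})" by (rule sum_card_swap) auto
    also have "\<dots> = (\<Sum>e\<in>T. 2)"
    proof (rule sum.cong)
      fix e assume "e \<in> T"
      then have "{v \<in> S. v \<in> e} = e" using T(1) by auto
      then show "card {v \<in> S. v \<in> e} = 2" using T(1) \<open>e \<in> T\<close> by simp
    qed simp
    finally show False using T(3) by simp
  qed
  then obtain v where v: "v \<in> S" "?d v < 2" by blast
  with ge[of v] have "?d v = 1" by linarith
  then obtain e where e: "{e \<in> T. v \<in> e} = {e}" by (auto simp: card_1_singleton_iff)
  then have eT: "e \<in> T" "v \<in> e" by auto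
  then obtain w where w: "e = {v, w}" "v \<noteq> w" using T(1)[of e] by (auto simp: card_2_iff)
  have "tree (S - {v}) (T - {{v, w}})"
    unfolding tree_def
  proof (intro conjI ballI)
    fix f assume f: "f \<in> T - {{v, w}}"
    then have "v \<notin> f" using e w by auto
    then show "f \<subseteq> S - {v}" "card f = 2" using f T(1) by auto
  next
    show "count_sparse 1 1 (T - {{v, w}})" by (rule count_sparse_subset[OF T(2)]) auto
    have "card (T - {{v, w}}) = card T - 1" using eT w by simp
    moreover have "card (S - {v}) + 1 = card S" using v S by simp
    moreover have "card T \<noteq> 0" using eT by auto
    ultimately show "card (T - {{v, w}}) + 1 = card (S - {v})" using T(3) by linarith
  qed
  then show thesis using v(1) w e T(1)[OF eT(1)] by (intro that[of v w]) auto
qed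

lemma tree_constant:
  fixes S :: "'v::finite set"
  assumes "tree S T" "\<And>v w. {v, w} \<in> T \<Longrightarrow> f v = f w"
  shows "\<exists>c. \<forall>v\<in>S. f v = c"
  using assms
proof (induction "card S" arbitrary: S T rule: less_induct)
  case less
  show ?case
  proof (cases "2 \<le> card S")
    case True
    obtain v w where vw: "v \<in> S" "w \<in> S - {v}" "{e \<in> T. v \<in> e} = {{v, w}}" "tree (S - {v}) (T - {{v, w}})"
      using tree_remove_leaf[OF less.prems(1) True] .
    obtain c where "\<forall>u\<in>S - {v}. f u = c"
      using less.hyps[OF _ vw(4)] less.prems(2) vw(1) True by auto
    moreover have "f v = f w" using vw(3) by (intro less.prems(2)) blast
    ultimately show ?thesis using vw(2) by (intro exI[of _ c]) auto
  next
    case False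
    then have "card S = 1" using less.prems(1) by (auto simp: tree_def)
    then show ?thesis by (auto simp: card_1_singleton_iff)
  qed
qed

section \<open>Estimates for attaching a leaf\<close>

lemma finite_uniform_less:
  fixes g :: "'a \<Rightarrow> real"
  assumes "finite A" "\<And>a. a \<in> A \<Longrightarrow> 0 < g a"
  shows "\<exists>\<epsilon>>0. \<forall>a\<in>A. \<epsilon> < g a"
  using assms
proof (induction A rule: finite_induct)
  case (insert a A)
  then have "\<exists>\<epsilon>>0. \<forall>a\<in>A. \<epsilon> < g a" "0 < g a" by simp_all
  then obtain \<epsilon> where "0 < \<epsilon>" "\<forall>a\<in>A. \<epsilon> < g a" "0 < g a" by blast
  then show ?case by (intro exI[of _ "min \<epsilon> (g a / 2)"]) (auto simp: min_less_iff_disj)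
qed (auto intro: exI[of _ 1])

lemma exists_unit_vector_avoiding:
  assumes "finite (D :: (real ^ 2) set)"
  shows "\<exists>d. norm d = 1 \<and> d \<notin> D"
proof -
  let ?f = "\<lambda>t. vector [cos t, sin t] :: real ^ 2"
  have "inj_on ?f {0..pi}"
  proof (rule inj_onI)
    fix s t assume "s \<in> {0..pi}" "t \<in> {0..pi}" "?f s = ?f t"
    then have "cos s = cos t" by (metis vector_2(1))
    then show "s = t" using \<open>s \<in> {0..pi}\<close> \<open>t \<in> {0..pi}\<close> cos_inj_pi by auto
  qed
  then have "infinite (?f ` {0..pi})" using finite_imageD infinite_Icc[OF pi_gt_zero] by blast
  then have "\<not> ?f ` {0..pi} \<subseteq> D" using assms finite_subset by blast
  then obtain t where "?f t \<notin> D" by blast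
  moreover have "norm (?f t) = 1" by (simp add: norm_eq_sqrt_inner inner_plane flip: power2_eq_square)
  ultimately show ?thesis by blast
qed

text \<open>The squares of the two sides differ by
  \<open>2 * \<epsilon> * (norm b - d \<bullet> b)\<close>, positive by strict Cauchy-Schwarz. So
  two light-like steps from one point into the same half of the cone, in different directions, end
  in a pair outside the cone.\<close>

lemma norm_diff_gt_if_not_parallel:
  fixes b d :: "'a::real_inner"
  assumes d: "norm d = 1" and b: "b \<noteq> norm b *\<^sub>R d" and \<epsilon>: "0 < \<epsilon>"
  shows "\<bar>\<epsilon> - norm b\<bar> < norm (\<epsilon> *\<^sub>R d - b)"
proof -
  have dd: "d \<bullet> d = 1" and bb: "b \<bullet> b = norm b * norm b"
    using d by (simp_all add: norm_eq_1 power2_norm_eq_inner flip: power2_eq_square)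
  have "0 < (b - norm b *\<^sub>R d) \<bullet> (b - norm b *\<^sub>R d)" using b by simp
  also have "\<dots> = 2 * norm b * (norm b - d \<bullet> b)"
    unfolding inner_diff_left inner_diff_right inner_scaleR_left inner_scaleR_right dd bb
      inner_commute[of b d] by (simp add: algebra_simps)
  finally have "0 < norm b - d \<bullet> b" by (simp add: zero_less_mult_iff)
  then have "0 < 2 * \<epsilon> * (norm b - d \<bullet> b)" using \<epsilon> by simp
  moreover have "(norm (\<epsilon> *\<^sub>R d - b))\<^sup>2 = (\<epsilon> - norm b)\<^sup>2 + 2 * \<epsilon> * (norm b - d \<bullet> b)"
    unfolding power2_norm_eq_inner inner_diff_left inner_diff_right inner_scaleR_left inner_scaleR_right
      dd bb inner_commute[of b d] by (simp add: algebra_simps power2_eq_square)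
  ultimately have "\<bar>\<epsilon> - norm b\<bar>\<^sup>2 < (norm (\<epsilon> *\<^sub>R d - b))\<^sup>2" by simp
  then show ?thesis by (rule power2_less_imp_less) simp
qed

text \<open>In terms of the quadratic form \<open>(norm x)\<^sup>2 - y\<^sup>2\<close>, tree edges are placed on the light cone and all other
  pairs outside it. A leaf is attached to \<open>w\<close> by a short step in a new light-like direction; the signs \<open>\<sigma>\<close>
  make all edges at \<open>w\<close> point to the same half of the cone, which separates the leaf from the other
  neighbours of \<open>w\<close>.\<close>

lemma tree_lightlike_realization:
  fixes S :: "'v::finite set"
  assumes "tree S T"
  shows "\<exists>(x :: 'v \<Rightarrow> real ^ 2) (y :: 'v \<Rightarrow> real) \<sigma>. (\<forall>v. \<sigma> v = 1 \<or> \<sigma> v = - 1) \<and>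
    (\<forall>v w. {v, w} \<in> T \<longrightarrow> x v \<noteq> x w \<and> y w - y v = \<sigma> v * norm (x w - x v)) \<and>
    (\<forall>v\<in>S. \<forall>w\<in>S. v \<noteq> w \<longrightarrow> {v, w} \<notin> T \<longrightarrow> \<bar>y v - y w\<bar> < norm (x v - x w))"
  using assms
proof (induction "card S" arbitrary: S T rule: less_induct)
  case less
  have T: "\<And>e. e \<in> T \<Longrightarrow> e \<subseteq> S \<and> card e = 2" using less.prems by (auto simp: tree_def)
  show ?case
  proof (cases "2 \<le> card S")
    case False
    moreover have "card T + 1 = card S" using less.prems by (simp add: tree_def)
    ultimately have "card S = 1" "card T = 0" by linarith+
    then obtain s where "S = {s}" "T = {}" by (auto simp: card_1_singleton_iff)
    then show ?thesis by (intro exI[of _ "\<lambda>_. 0"] exI[of _ "\<lambda>_. 1"]) auto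
  next
    case True
    obtain v w where vw: "v \<in> S" "w \<in> S - {v}" "{e \<in> T. v \<in> e} = {{v, w}}"
      and T': "tree (S - {v}) (T - {{v, w}})"
      using tree_remove_leaf[OF less.prems True] .
    have "card (S - {v}) < card S" using vw(1) by (intro psubset_card_mono) auto
    from less.hyps[OF this T'] obtain x :: "'v \<Rightarrow> real ^ 2" and y \<sigma> where
      \<sigma>: "\<forall>v. \<sigma> v = 1 \<or> \<sigma> v = - 1" and
      light: "\<forall>p q. {p, q} \<in> T - {{v, w}} \<longrightarrow> x p \<noteq> x q \<and> y q - y p = \<sigma> p * norm (x q - x p)" and
      space: "\<forall>p\<in>S - {v}. \<forall>q\<in>S - {v}. p \<noteq> q \<longrightarrow> {p, q} \<notin> T - {{v, w}} \<longrightarrow> \<bar>y p - y q\<bar> < norm (x p - x q)"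
      by auto
    obtain d where d: "norm d = 1" "d \<notin> (\<lambda>u. (1 / norm (x u - x w)) *\<^sub>R (x u - x w)) ` S"
      using exists_unit_vector_avoiding[of "(\<lambda>u. (1 / norm (x u - x w)) *\<^sub>R (x u - x w)) ` S"] by auto
    let ?A = "{u \<in> S - {v}. u \<noteq> w \<and> {w, u} \<notin> T}"
    have "\<exists>\<epsilon>>0. \<forall>u\<in>?A. \<epsilon> < (norm (x w - x u) - \<bar>y w - y u\<bar>) / 2"
      by (rule finite_uniform_less) (use space vw(2) in auto)
    then obtain \<epsilon> where \<epsilon>: "0 < \<epsilon>" "\<And>u. u \<in> ?A \<Longrightarrow> 2 * \<epsilon> < norm (x w - x u) - \<bar>y w - y u\<bar>"
      by (auto simp: field_simps)
    \<comment> \<open>Seen from \<open>v\<close>, the edge to \<open>w\<close> points into the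
      opposite half of the cone, hence the sign \<open>- \<sigma> w\<close>.\<close>
    let ?x = "x(v := x w + \<epsilon> *\<^sub>R d)" and ?y = "y(v := y w + \<sigma> w * \<epsilon>)" and ?\<sigma> = "\<sigma>(v := - \<sigma> w)"
    have wv: "w \<noteq> v" "w \<in> S" using vw(2) by auto
    have abs\<sigma>: "\<bar>\<sigma> w * t\<bar> = \<bar>t\<bar>" for t using \<sigma> by (metis abs_mult abs_1 abs_minus_cancel mult_1)
    have new: "\<bar>?y v - ?y u\<bar> < norm (?x v - ?x u)" if u: "u \<in> S" "u \<noteq> v" "{v, u} \<notin> T" for u
    proof -
      have "u \<noteq> w" using u vw(3) by auto
      show ?thesis
      proof (cases "{w, u} \<in> T")
        case True
        then have "{w, u} \<in> T - {{v, w}}" using u(2) \<open>u \<noteq> w\<close> by (auto simp: doubleton_eq_iff)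
        then have l: "x w \<noteq> x u" "y u - y w = \<sigma> w * norm (x u - x w)" using light by blast+
        let ?b = "x u - x w"
        have "?b \<noteq> norm ?b *\<^sub>R d"
        proof
          assume "?b = norm ?b *\<^sub>R d"
          moreover have "norm ?b \<noteq> 0" using l(1) by simp
          ultimately have "d = (1 / norm ?b) *\<^sub>R ?b" by (metis divideR_right inverse_eq_divide)
          then show False using d(2) u(1) by blast
        qed
        then have "\<bar>\<epsilon> - norm ?b\<bar> < norm (\<epsilon> *\<^sub>R d - ?b)" by (rule norm_diff_gt_if_not_parallel[OF d(1) _ \<epsilon>(1)])
        moreover have "?y v - ?y u = \<sigma> w * (\<epsilon> - norm ?b)" using u(2) l(2) by (simp add: algebra_simps)
        moreover have "?x v - ?x u = \<epsilon> *\<^sub>R d - ?b" using u(2) by simp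
        ultimately show ?thesis using abs\<sigma> by metis
      next
        case False
        \<comment> \<open>Passing from \<open>w\<close> to \<open>v\<close> changes the height and
          the planar position by at most \<epsilon> each, within the slack.\<close>
        then have "2 * \<epsilon> < norm (x w - x u) - \<bar>y w - y u\<bar>" using u \<open>u \<noteq> w\<close> by (intro \<epsilon>(2)) auto
        moreover have "\<bar>?y v - ?y u\<bar> \<le> \<bar>y w - y u\<bar> + \<epsilon>"
          using abs_triangle_ineq[of "y w - y u" "\<sigma> w * \<epsilon>"] abs\<sigma>[of \<epsilon>] u(2) \<epsilon>(1) by (simp add: algebra_simps)
        moreover have "norm (x w - x u) \<le> norm (?x v - ?x u) + \<epsilon>"
          using norm_triangle_ineq4[of "?x v - ?x u" "\<epsilon> *\<^sub>R d"] d(1) u(2) \<epsilon>(1) by (simp add: algebra_simps)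
        ultimately show ?thesis by linarith
      qed
    qed
    have inT: "p = w \<and> q = v \<or> p = v \<and> q = w \<or> (p \<noteq> v \<and> q \<noteq> v \<and> {p, q} \<in> T - {{v, w}})" if "{p, q} \<in> T" for p q
    proof (cases "v \<in> {p, q}")
      case True
      then have "{p, q} \<in> {e \<in> T. v \<in> e}" using that by simp
      then have "{p, q} = {v, w}" unfolding vw(3) by simp
      then show ?thesis by (auto simp: doubleton_eq_iff)
    qed (use that in auto)
    show ?thesis
    proof (rule exI[of _ ?x], rule exI[of _ ?y], rule exI[of _ ?\<sigma>], intro conjI allI ballI impI)
      fix p show "?\<sigma> p = 1 \<or> ?\<sigma> p = - 1" using \<sigma>[rule_format, of p] \<sigma>[rule_format, of w] by auto
    next
      fix p q assume pq: "{p, q} \<in> T"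
      have d0: "d \<noteq> 0" using d(1) by auto
      show "?x p \<noteq> ?x q" using inT[OF pq] light wv d0 \<epsilon>(1) by auto
      show "?y q - ?y p = ?\<sigma> p * norm (?x q - ?x p)" using inT[OF pq] light wv d(1) \<epsilon>(1) by auto
    next
      fix p q assume pq: "p \<in> S" "q \<in> S" "p \<noteq> q" "{p, q} \<notin> T"
      consider "p = v" | "q = v" | "p \<noteq> v" "q \<noteq> v" by blast
      then show "\<bar>?y p - ?y q\<bar> < norm (?x p - ?x q)"
      proof cases
        case 1 then show ?thesis using new[of q] pq by auto
      next
        case 2 
        then have "\<bar>?y v - ?y p\<bar> < norm (?x v - ?x p)" using pq by (intro new) (auto simp: insert_commute)
        then show ?thesis using 2 by (simp add: abs_minus_commute norm_minus_commute)
      next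
        case 3 then show ?thesis using space pq by auto
      qed
    qed
  qed
qed

text \<open>Stretching the heights by \<open>1 + \<delta>\<close> moves the tree edges from the cone
  strictly inside it, while the finitely many other pairs stay outside for small \<delta>.\<close>

lemma tree_timelike_realization:
  fixes T :: "'v::finite set set"
  assumes tree: "tree UNIV T"
  obtains x :: "'v \<Rightarrow> real ^ 2" and y :: "'v \<Rightarrow> real" and \<epsilon> where "0 < \<epsilon>"
    "\<And>x' v w. \<forall>v. norm (x' v - x v) < \<epsilon> \<Longrightarrow> {v, w} \<in> T \<Longrightarrow> norm (x' v - x' w) < \<bar>y v - y w\<bar>"
    "\<And>x' v w. \<forall>v. norm (x' v - x v) < \<epsilon> \<Longrightarrow> v \<noteq> w \<Longrightarrow> {v, w} \<notin> T \<Longrightarrow> \<bar>y v - y w\<bar> < norm (x' v - x' w)"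
proof -
  obtain x :: "'v \<Rightarrow> real ^ 2" and y \<sigma> where \<sigma>: "\<forall>v. \<sigma> v = 1 \<or> \<sigma> v = - 1" and
    light: "\<And>v w. {v, w} \<in> T \<Longrightarrow> x v \<noteq> x w \<and> y w - y v = \<sigma> v * norm (x w - x v)" and
    space: "\<And>v w. v \<noteq> w \<Longrightarrow> {v, w} \<notin> T \<Longrightarrow> \<bar>y v - y w\<bar> < norm (x v - x w)"
    using tree_lightlike_realization[OF tree] by (elim exE conjE) (metis UNIV_I)
  let ?P = "{(v, w). v \<noteq> w \<and> {v, w} \<notin> T}"
  have "\<exists>\<delta>>0. \<forall>(v, w)\<in>?P. \<delta> < (norm (x v - x w) - \<bar>y v - y w\<bar>) / (\<bar>y v - y w\<bar> + 1)"
    using finite_uniform_less[of ?P "\<lambda>(v, w). (norm (x v - x w) - \<bar>y v - y w\<bar>) / (\<bar>y v - y w\<bar> + 1)"] space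
    by (auto simp: case_prod_unfold)
  then obtain \<delta> where \<delta>: "0 < \<delta>"
    "\<And>v w. v \<noteq> w \<Longrightarrow> {v, w} \<notin> T \<Longrightarrow> \<delta> < (norm (x v - x w) - \<bar>y v - y w\<bar>) / (\<bar>y v - y w\<bar> + 1)"
    by blast
  define y' where "y' v = (1 + \<delta>) * y v" for v
  have y': "\<bar>y' v - y' w\<bar> = (1 + \<delta>) * \<bar>y v - y w\<bar>" for v w
    unfolding y'_def using \<delta>(1) by (simp add: abs_mult flip: right_diff_distrib)
  have time: "norm (x v - x w) < \<bar>y' v - y' w\<bar>" if "{v, w} \<in> T" for v w
  proof -
    have "\<bar>y w - y v\<bar> = norm (x w - x v)" using light[OF that] \<sigma> by (metis abs_1 abs_minus_cancel abs_mult abs_norm_cancel mult_1)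
    then have "\<bar>y v - y w\<bar> = norm (x v - x w)" by (simp add: abs_minus_commute norm_minus_commute)
    moreover have "0 < norm (x v - x w)" using light[OF that] by simp
    ultimately show ?thesis unfolding y' using \<delta>(1) by simp
  qed
  have space': "\<bar>y' v - y' w\<bar> < norm (x v - x w)" if "v \<noteq> w" "{v, w} \<notin> T" for v w
  proof -
    have "\<delta> * (\<bar>y v - y w\<bar> + 1) < norm (x v - x w) - \<bar>y v - y w\<bar>"
      using \<delta>(2)[OF that] by (simp add: pos_less_divide_eq)
    then show ?thesis unfolding y' using \<delta>(1) by (simp add: algebra_simps)
  qed
  let ?Q = "{(v, w). v \<noteq> w}"
  \<comment> \<open>Half the gap, as both endpoints of a pair may move.\<close>
  have "0 < \<bar>\<bar>y' v - y' w\<bar> - norm (x v - x w)\<bar> / 2" if "v \<noteq> w" for v w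
    using time[of v w] space'[OF that] by fastforce
  then have "\<exists>\<epsilon>>0. \<forall>(v, w)\<in>?Q. \<epsilon> < \<bar>\<bar>y' v - y' w\<bar> - norm (x v - x w)\<bar> / 2"
    using finite_uniform_less[of ?Q "\<lambda>(v, w). \<bar>\<bar>y' v - y' w\<bar> - norm (x v - x w)\<bar> / 2"]
    by (auto simp: case_prod_unfold)
  then obtain \<epsilon> where \<epsilon>: "0 < \<epsilon>" "\<And>v w. v \<noteq> w \<Longrightarrow> \<epsilon> < \<bar>\<bar>y' v - y' w\<bar> - norm (x v - x w)\<bar> / 2"
    by blast
  have near: "\<bar>norm (x' v - x' w) - norm (x v - x w)\<bar> < 2 * \<epsilon>" if "\<forall>v. norm (x' v - x v) < \<epsilon>" for x' v w
  proof -
    have "\<bar>norm (x' v - x' w) - norm (x v - x w)\<bar> \<le> norm ((x' v - x' w) - (x v - x w))"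
      by (rule norm_triangle_ineq3)
    also have "\<dots> = norm ((x' v - x v) - (x' w - x w))" by (simp add: algebra_simps)
    also have "\<dots> \<le> norm (x' v - x v) + norm (x' w - x w)" by (rule norm_triangle_ineq4)
    finally show ?thesis using that[rule_format, of v] that[rule_format, of w] by linarith
  qed
  show thesis
  proof (rule that[OF \<epsilon>(1)])
    fix x' :: "'v \<Rightarrow> real ^ 2" and v w
    assume x': "\<forall>v. norm (x' v - x v) < \<epsilon>"
    show "norm (x' v - x' w) < \<bar>y' v - y' w\<bar>" if vw: "{v, w} \<in> T"
    proof -
      have "v \<noteq> w" using light[OF vw] by auto
      from \<epsilon>(2)[OF this] time[OF vw] have "2 * \<epsilon> < \<bar>y' v - y' w\<bar> - norm (x v - x w)" by simp
      then show ?thesis using near[OF x', of v w] by linarith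
    qed
    show "\<bar>y' v - y' w\<bar> < norm (x' v - x' w)" if "v \<noteq> w" "{v, w} \<notin> T"
    proof -
      from \<epsilon>(2)[OF that(1)] space'[OF that] have "2 * \<epsilon> < norm (x v - x w) - \<bar>y' v - y' w\<bar>" by simp
      then show ?thesis using near[OF x', of v w] by linarith
    qed
  qed
qed

section \<open>Frameworks in the cylinder\<close>

lemma linf_fst_simps [simp]:
  "linf_fst (a + b) = linf_fst a + linf_fst b" "linf_fst (a - b) = linf_fst a - linf_fst b"
  "linf_fst (r *\<^sub>R a) = r *\<^sub>R linf_fst a"
  "linf_snd (a + b) = linf_snd a + linf_snd b" "linf_snd (a - b) = linf_snd a - linf_snd b"
  "linf_snd (r *\<^sub>R a) = r *\<^sub>R linf_snd a"
  by (simp_all add: plus_linf_sum_def minus_linf_sum_def scaleR_linf_sum_def)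

lemma bounded_linear_linf_fst: "bounded_linear linf_fst"
  by (rule bounded_linear_intro[where K = 1]) (simp_all add: norm_linf_sum_def)

lemma bounded_linear_linf_snd: "bounded_linear linf_snd"
  by (rule bounded_linear_intro[where K = 1]) (simp_all add: norm_linf_sum_def)

lemma bounded_linear_Linf_left: "bounded_linear (\<lambda>a. Linf a 0)"
  by (rule bounded_linear_intro[where K = 1])
     (simp_all add: norm_linf_sum_def plus_linf_sum_def scaleR_linf_sum_def)

lemma bounded_linear_Linf_right: "bounded_linear (Linf 0)"
  by (rule bounded_linear_intro[where K = 1])
     (simp_all add: norm_linf_sum_def plus_linf_sum_def scaleR_linf_sum_def)

lemma has_vector_derivative_Linf:
  assumes "(f has_vector_derivative f') F" "(g has_vector_derivative g') F"
  shows "((\<lambda>t. Linf (f t) (g t)) has_vector_derivative Linf f' g') F"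
proof -
  have "((\<lambda>t. Linf (f t) 0 + Linf 0 (g t)) has_vector_derivative Linf f' 0 + Linf 0 g') F"
    by (rule has_vector_derivative_add[OF
          bounded_linear.has_vector_derivative[OF bounded_linear_Linf_left assms(1)]
          bounded_linear.has_vector_derivative[OF bounded_linear_Linf_right assms(2)]])
  then show ?thesis by (simp add: plus_linf_sum_def)
qed

text \<open>Strict dominance of the first part is an open condition, and under it the maximum norm
  is the inner product norm of that part.\<close>

lemma edge_length_has_derivative_fst:
  fixes p :: "('a::real_inner, 'b::real_normed_vector) linf_sum ^ 'v::finite"
  assumes less: "norm (linf_snd (p $ v - p $ w)) < norm (linf_fst (p $ v - p $ w))"
  shows "((\<lambda>q. edge_length q {v, w}) has_derivative
    (\<lambda>u. linf_fst (u $ v - u $ w) \<bullet> sgn (linf_fst (p $ v - p $ w)))) (at p)"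
proof -
  let ?f = "\<lambda>q :: ('a, 'b) linf_sum ^ 'v. linf_fst (q $ v - q $ w)"
  let ?g = "\<lambda>q :: ('a, 'b) linf_sum ^ 'v. linf_snd (q $ v - q $ w)"
  have lin: "bounded_linear ?f" "bounded_linear ?g"
    by (intro bounded_linear_compose[OF bounded_linear_linf_fst]
        bounded_linear_compose[OF bounded_linear_linf_snd] bounded_linear_sub bounded_linear_vec_nth)+
  have "((\<lambda>q. norm (?f q)) has_derivative (\<lambda>u. ?f u \<bullet> sgn (?f p))) (at p)"
    using less by (intro has_derivative_compose[OF bounded_linear_imp_has_derivative[OF lin(1)] has_derivative_norm]) auto
  moreover have "open {q. norm (?g q) < norm (?f q)}"
    by (intro open_Collect_less continuous_on_norm linear_continuous_on lin)
  ultimately show ?thesis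
    by (rule has_derivative_transform_within_open)
       (use less in \<open>auto simp: edge_length_doubleton norm_linf_sum_def\<close>)
qed

lemma edge_length_has_derivative_snd:
  fixes p :: "('a::real_normed_vector, 'b::real_inner) linf_sum ^ 'v::finite"
  assumes less: "norm (linf_fst (p $ v - p $ w)) < norm (linf_snd (p $ v - p $ w))"
  shows "((\<lambda>q. edge_length q {v, w}) has_derivative
    (\<lambda>u. linf_snd (u $ v - u $ w) \<bullet> sgn (linf_snd (p $ v - p $ w)))) (at p)"
proof -
  let ?f = "\<lambda>q :: ('a, 'b) linf_sum ^ 'v. linf_fst (q $ v - q $ w)"
  let ?g = "\<lambda>q :: ('a, 'b) linf_sum ^ 'v. linf_snd (q $ v - q $ w)"
  have lin: "bounded_linear ?f" "bounded_linear ?g"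
    by (intro bounded_linear_compose[OF bounded_linear_linf_fst]
        bounded_linear_compose[OF bounded_linear_linf_snd] bounded_linear_sub bounded_linear_vec_nth)+
  have "((\<lambda>q. norm (?g q)) has_derivative (\<lambda>u. ?g u \<bullet> sgn (?g p))) (at p)"
    using less by (intro has_derivative_compose[OF bounded_linear_imp_has_derivative[OF lin(2)] has_derivative_norm]) auto
  moreover have "open {q. norm (?f q) < norm (?g q)}"
    by (intro open_Collect_less continuous_on_norm linear_continuous_on lin)
  ultimately show ?thesis
    by (rule has_derivative_transform_within_open)
       (use less in \<open>auto simp: edge_length_doubleton norm_linf_sum_def\<close>)
qed

section \<open>The derivative of the rigidity map and the trivial motions\<close>

lemma rigidity_map_has_derivative:
  fixes p :: "'a::real_normed_vector ^ 'v::finite"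
  assumes "\<And>e. e \<in> E \<Longrightarrow> ((\<lambda>q. edge_length q e) has_derivative D e) (at p)"
  shows "(rigidity_map E has_derivative (\<lambda>u. \<chi> e. if e \<in> E then D e u else 0)) (at p)"
  unfolding has_derivative_componentwise_within[of "rigidity_map E"]
proof
  fix i :: "real ^ 'v set" assume "i \<in> Basis"
  then obtain e where i: "i = axis e 1" by (auto simp: Basis_vec_def)
  show "((\<lambda>q. rigidity_map E q \<bullet> i) has_derivative (\<lambda>u. (\<chi> e. if e \<in> E then D e u else 0) \<bullet> i)) (at p)"
    unfolding i inner_axis using assms by (cases "e \<in> E") (auto simp: rigidity_map_def)
qed

lemma bounded_linear_axis: "bounded_linear (axis i :: 'a::real_normed_vector \<Rightarrow> 'a ^ 'n::finite)"
proof (rule bounded_linear_intro[where K = 1])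
  fix x :: 'a
  have "norm (axis i x) \<le> (\<Sum>j\<in>UNIV. norm (axis i x $ j))"
    unfolding norm_vec_def by (rule L2_set_le_sum) simp
  also have "\<dots> = (\<Sum>j\<in>UNIV. if j = i then norm x else 0)"
    by (rule sum.cong) (auto simp: axis_def)
  finally show "norm (axis i x) \<le> norm x * 1" by simp
qed (simp_all add: axis_def vec_eq_iff)

lemma has_vector_derivative_vec_lambda:
  fixes f :: "'n::finite \<Rightarrow> real \<Rightarrow> 'a::real_normed_vector"
  assumes "\<And>i. (f i has_vector_derivative f' i) F"
  shows "((\<lambda>t. \<chi> i. f i t) has_vector_derivative (\<chi> i. f' i)) F"
proof -
  have expand: "(\<chi> i. a i) = (\<Sum>i\<in>UNIV. axis i (a i))" for a :: "'n \<Rightarrow> 'a"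
    by (simp add: vec_eq_iff sum_component axis_def)
  have "((\<lambda>t. \<Sum>i\<in>UNIV. axis i (f i t)) has_vector_derivative (\<Sum>i\<in>UNIV. axis i (f' i))) F"
    by (intro has_vector_derivative_sum bounded_linear.has_vector_derivative[OF bounded_linear_axis] assms)
  then show ?thesis by (simp only: expand)
qed

text \<open>Edge lengths are constant along a rigid motion, so the chain rule gives 0; derivatives
  within \<open>{-1..1}\<close> are unique.\<close>

lemma trivial_motions_in_kernel:
  fixes p :: "'a::real_normed_vector ^ 'v::finite"
  assumes diff: "(rigidity_map E has_derivative D) (at p)" and E: "\<And>e. e \<in> E \<Longrightarrow> card e = 2"
    and u: "u \<in> trivial_motions p"
  shows "D u = 0"
proof -
  obtain \<eta> \<alpha> where u: "u = (\<chi> v. \<eta> (p $ v))" and \<alpha>: "rigid_motion \<alpha>"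
    and \<eta>: "\<And>x. (\<alpha> x has_vector_derivative \<eta> x) (at 0 within {-1..1})"
    using u by (auto simp: trivial_motions_def infinitesimal_rigid_motions_def)
  let ?\<gamma> = "\<lambda>t. \<chi> v. \<alpha> (p $ v) t"
  have \<gamma>0: "?\<gamma> 0 = p" using \<alpha> by (simp add: rigid_motion_def vec_eq_iff)
  have "(?\<gamma> has_vector_derivative u) (at 0 within {-1..1})"
    unfolding u by (rule has_vector_derivative_vec_lambda[OF \<eta>])
  moreover have "(rigidity_map E has_derivative D) (at (?\<gamma> 0) within ?\<gamma> ` {-1..1})"
    unfolding \<gamma>0 by (rule has_derivative_at_withinI[OF diff])
  ultimately have "((rigidity_map E \<circ> ?\<gamma>) has_vector_derivative D u) (at 0 within {-1..1})"
    by (rule vector_derivative_diff_chain_within)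
  then have "((\<lambda>t. rigidity_map E p) has_vector_derivative D u) (at 0 within {-1..1})"
  proof (rule has_vector_derivative_transform[rotated 2])
    fix t :: real assume t: "t \<in> {-1..1}"
    have "edge_length p e = edge_length (?\<gamma> t) e" if "e \<in> E" for e
    proof -
      obtain v w where "e = {v, w}" using E[OF \<open>e \<in> E\<close>] by (auto simp: card_2_iff)
      then show ?thesis using \<alpha> t by (simp add: edge_length_doubleton rigid_motion_def)
    qed
    then show "rigidity_map E p = (rigidity_map E \<circ> ?\<gamma>) t" by (auto simp: rigidity_map_def vec_eq_iff)
  qed simp
  moreover have "((\<lambda>t. rigidity_map E p) has_vector_derivative 0) (at 0 within {-1..1})" by simp
  ultimately show ?thesis
    using vector_derivative_unique_within_closed_interval[of "-1::real" 1 0 "\<lambda>t. rigidity_map E p" "D u" 0]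
    by (simp add: cbox_interval)
qed

lemma norm_rotation: "norm (cos \<theta> *\<^sub>R z + sin \<theta> *\<^sub>R rot z) = norm z"
proof -
  have "(cos \<theta> * z $ 1 - sin \<theta> * z $ 2)\<^sup>2 + (cos \<theta> * z $ 2 + sin \<theta> * z $ 1)\<^sup>2
      = ((cos \<theta>)\<^sup>2 + (sin \<theta>)\<^sup>2) * ((z $ 1)\<^sup>2 + (z $ 2)\<^sup>2)"
    by algebra
  then show ?thesis by (simp add: norm_eq_sqrt_inner inner_plane flip: power2_eq_square)
qed

text \<open>The isometries of the cylinder need not be classified: the kernel is shown to consist of
  motions of this form, and \<open>trivial_motions_in_kernel\<close> gives the converse inclusion.
  The path rotates by \<open>t * c\<close> and translates by \<open>t * b\<close> and
  \<open>t * s\<close>.\<close>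

lemma cylinder_infinitesimal_rigid_motion:
  "(\<lambda>z. Linf (c *\<^sub>R rot (linf_fst z) + b) s) \<in> (infinitesimal_rigid_motions :: (cylinder \<Rightarrow> cylinder) set)"
proof -
  define \<alpha> :: "cylinder \<Rightarrow> real \<Rightarrow> cylinder" where
    "\<alpha> z t = Linf (cos (t * c) *\<^sub>R linf_fst z + sin (t * c) *\<^sub>R rot (linf_fst z) + t *\<^sub>R b) (linf_snd z + t * s)" for z t
  have D: "(\<alpha> z has_vector_derivative
      Linf ((- (c * sin (t * c))) *\<^sub>R linf_fst z + (c * cos (t * c)) *\<^sub>R rot (linf_fst z) + b) s) (at t within A)" for z t A
    unfolding \<alpha>_def
    by (intro has_vector_derivative_Linf) (auto intro!: derivative_eq_intros simp: mult.commute)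
  have \<alpha>0: "\<alpha> z 0 = z" for z by (cases z) (simp add: \<alpha>_def)
  have "norm (\<alpha> z t - \<alpha> w t) = norm (z - w)" for z w t
  proof -
    have "linf_fst (\<alpha> z t - \<alpha> w t)
        = cos (t * c) *\<^sub>R linf_fst (z - w) + sin (t * c) *\<^sub>R rot (linf_fst (z - w))"
      by (simp add: \<alpha>_def linear_diff[OF linear_rot] algebra_simps)
    moreover have "linf_snd (\<alpha> z t - \<alpha> w t) = linf_snd (z - w)" by (simp add: \<alpha>_def)
    ultimately show ?thesis by (simp only: norm_linf_sum_def norm_rotation)
  qed
  moreover have "continuous_on {-1..1} (\<alpha> z)" for z
    using D has_vector_derivative_continuous by (fastforce simp: continuous_on_eq_continuous_within)
  moreover have "\<alpha> z differentiable (at 0 within {-1..1})" for z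
    using D differentiableI_vector by blast
  ultimately have "rigid_motion \<alpha>" using \<alpha>0 by (simp add: rigid_motion_def)
  moreover have "(\<alpha> z has_vector_derivative Linf (c *\<^sub>R rot (linf_fst z) + b) s) (at 0 within {-1..1})" for z
    using D[of z 0 "{-1..1}"] by simp
  ultimately show ?thesis unfolding infinitesimal_rigid_motions_def by blast
qed

theorem cylinder_rigid_if_tree_and_laman:
  fixes E H T :: "'v::finite set set"
  assumes E: "\<And>e. e \<in> E \<Longrightarrow> card e = 2" and HT: "H \<subseteq> E" "T \<subseteq> E" "H \<inter> T = {}"
    and laman: "laman UNIV H" and tree: "tree UNIV T" and two: "2 \<le> CARD('v)"
  shows "rigid_in TYPE(cylinder) E"
proof -
  obtain x0 :: "'v \<Rightarrow> real ^ 2" and y :: "'v \<Rightarrow> real" and \<epsilon> where \<epsilon>: "0 < \<epsilon>"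
    and time: "\<And>x v w. \<forall>v. norm (x v - x0 v) < \<epsilon> \<Longrightarrow> {v, w} \<in> T \<Longrightarrow> norm (x v - x w) < \<bar>y v - y w\<bar>"
    and space: "\<And>x v w. \<forall>v. norm (x v - x0 v) < \<epsilon> \<Longrightarrow> v \<noteq> w \<Longrightarrow> {v, w} \<notin> T \<Longrightarrow> \<bar>y v - y w\<bar> < norm (x v - x w)"
    by (rule tree_timelike_realization[OF tree]) (rule that)
  \<comment> \<open>Within \<epsilon> of \<open>x0\<close> the vertical pairs are still exactly the
    tree edges.\<close>
  obtain x where x: "\<forall>v. norm (x v - x0 v) < \<epsilon>" and rigid: "plane_rigid UNIV H x"
    using laman_rigid_dense[OF laman _ \<epsilon>] two by blast
  note time = time[OF x] and space = space[OF x]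
  define p :: "cylinder ^ 'v" where "p = (\<chi> v. Linf (x v) (y v))"
  have p: "linf_fst (p $ v - p $ w) = x v - x w" "linf_snd (p $ v - p $ w) = y v - y w" for v w
    by (simp_all add: p_def)
  have E_ne: "v \<noteq> w" if "{v, w} \<in> E" for v w using E[OF that] by auto
  have D_T: "((\<lambda>q. edge_length q {v, w}) has_derivative (\<lambda>u. linf_snd (u $ v - u $ w) \<bullet> sgn (y v - y w))) (at p)"
    if "{v, w} \<in> T" for v w
    using edge_length_has_derivative_snd[of p v w] time[OF that] unfolding p real_norm_def by simp
  have D_S: "((\<lambda>q. edge_length q {v, w}) has_derivative (\<lambda>u. linf_fst (u $ v - u $ w) \<bullet> sgn (x v - x w))) (at p)"
    if "v \<noteq> w" "{v, w} \<notin> T" for v w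
    using edge_length_has_derivative_fst[of p v w] space[OF that] unfolding p real_norm_def by simp
  have "\<exists>D. ((\<lambda>q. edge_length q e) has_derivative D) (at p)" if "e \<in> E" for e
  proof -
    obtain v w where e: "e = {v, w}" "v \<noteq> w" using E[OF \<open>e \<in> E\<close>] by (auto simp: card_2_iff)
    then show ?thesis using D_T[of v w] D_S[of v w] by (cases "{v, w} \<in> T") blast+
  qed
  \<comment> \<open>\<open>D e\<close> depends on no order of the endpoints;
    \<open>has_derivative_unique\<close> later identifies it with the formula for the order at
    hand.\<close>
  then obtain D where D: "\<And>e. e \<in> E \<Longrightarrow> ((\<lambda>q. edge_length q e) has_derivative D e) (at p)" by metis
  define D' where "D' u = (\<chi> e. if e \<in> E then D e u else 0)" for u
  have D': "(rigidity_map E has_derivative D') (at p)"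
    unfolding D'_def[abs_def] by (rule rigidity_map_has_derivative[OF D])
  have fd: "frechet_derivative (rigidity_map E) (at p) = D'"
    by (rule frechet_derivative_at[OF D', symmetric])
  have "framework E p"
    unfolding framework_def
  proof (intro allI impI notI)
    fix v w assume "{v, w} \<in> E" "p $ v = p $ w"
    then have "x v = x w" "y v = y w" by (simp_all add: p_def)
    then show False using time[of v w] space[of v w] E_ne[OF \<open>{v, w} \<in> E\<close>] by (cases "{v, w} \<in> T") auto
  qed
  moreover have "well_positioned E p"
    unfolding well_positioned_def using D' by (rule differentiableI)
  moreover have "infinitesimally_rigid E p"
    unfolding infinitesimally_rigid_def fd
  proof (intro subset_antisym subsetI)
    fix u assume "u \<in> trivial_motions p"
    then show "u \<in> {u. D' u = 0}" using trivial_motions_in_kernel[OF D' E] by simp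
  next
    fix u assume "u \<in> {u. D' u = 0}"
    then have ker: "D e u = 0" if "e \<in> E" for e
      using that by (auto simp: D'_def vec_eq_iff dest: spec[of _ e])
    have "linf_snd (u $ v) = linf_snd (u $ w)" if vw: "{v, w} \<in> T" for v w
    proof -
      have *: "{v, w} \<in> E" using vw HT(2) by blast
      have "linf_snd (u $ v - u $ w) \<bullet> sgn (y v - y w) = D {v, w} u"
        unfolding has_derivative_unique[OF D[OF *] D_T[OF vw]] ..
      then have "linf_snd (u $ v - u $ w) \<bullet> sgn (y v - y w) = 0" using ker[OF *] by simp
      moreover have "y v - y w \<noteq> 0" using time[OF vw] by auto
      ultimately show ?thesis by (simp add: sgn_eq_0_iff)
    qed
    then obtain s where s: "\<And>v. linf_snd (u $ v) = s"
      using tree_constant[OF tree, of "\<lambda>v. linf_snd (u $ v)"] by auto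
    have "flex H x (\<lambda>v. linf_fst (u $ v))"
      unfolding flex_def
    proof (intro allI impI)
      fix v w assume vw: "{v, w} \<in> H"
      then have "{v, w} \<in> E" "{v, w} \<notin> T" using HT by blast+
      then have *: "{v, w} \<in> E" "v \<noteq> w" "{v, w} \<notin> T" using E_ne[of v w] by blast+
      have "linf_fst (u $ v - u $ w) \<bullet> sgn (x v - x w) = D {v, w} u"
        unfolding has_derivative_unique[OF D[OF *(1)] D_S[OF *(2,3)]] ..
      then have "linf_fst (u $ v - u $ w) \<bullet> sgn (x v - x w) = 0" using ker[OF *(1)] by simp
      moreover have "x v - x w \<noteq> 0" using space[OF *(2,3)] by auto
      ultimately show "(x v - x w) \<bullet> (linf_fst (u $ v) - linf_fst (u $ w)) = 0"
        by (simp add: sgn_div_norm inner_commute)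
    qed
    then obtain c b where cb: "\<And>v. linf_fst (u $ v) = c *\<^sub>R rot (x v) + b"
      using rigid unfolding plane_rigid_def by blast
    have "u = (\<chi> v. Linf (c *\<^sub>R rot (linf_fst (p $ v)) + b) s)"
      unfolding vec_eq_iff
    proof
      fix v show "u $ v = (\<chi> v. Linf (c *\<^sub>R rot (linf_fst (p $ v)) + b) s) $ v"
        using cb[of v] s[of v] by (cases "u $ v") (simp add: p_def)
    qed
    then show "u \<in> trivial_motions p"
      unfolding trivial_motions_def using cylinder_infinitesimal_rigid_motion[of c b s]
      by (intro CollectI exI[of _ "\<lambda>z. Linf (c *\<^sub>R rot (linf_fst z) + b) s"] conjI)
  qed
  ultimately show ?thesis unfolding rigid_in_def by blast
qed

section \<open>Connectivity\<close>

lemma connected_graph_closed: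
  assumes "connected_graph G" "s \<in> verts G" "t \<in> verts G" "s \<in> S"
    and closed: "\<And>a b. a \<in> S \<Longrightarrow> {a, b} \<in> edges G \<Longrightarrow> b \<in> S"
  shows "t \<in> S"
proof -
  have "(s, t) \<in> {(x, y). {x, y} \<in> edges G}\<^sup>*" using assms(1-3) by (auto simp: connected_graph_def)
  then show ?thesis by (induction rule: rtrancl_induct) (use assms(4) closed in auto)
qed

lemma edge_connected_cut:
  fixes G :: "'v::finite graph"
  assumes conn: "edge_connected k G" and E: "\<And>e. e \<in> edges G \<Longrightarrow> e \<subseteq> verts G"
    and S: "S \<subseteq> verts G" "S \<noteq> {}" "S \<noteq> verts G"
  shows "k \<le> card (cut (edges G) S (verts G - S))"
proof (rule ccontr)
  let ?F = "cut (edges G) S (verts G - S)"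
  assume "\<not> ?thesis"
  then have c: "connected_graph (delete_edges G ?F)"
    using conn by (auto simp: edge_connected_def cut_def)
  obtain s t where st: "s \<in> S" "t \<in> verts G" "t \<notin> S" using S by blast
  have "t \<in> S"
  proof (rule connected_graph_closed[OF c])
    fix a b assume ab: "a \<in> S" "{a, b} \<in> edges (delete_edges G ?F)"
    then have "{a, b} \<in> edges G" "{a, b} \<notin> ?F" by (simp_all add: delete_edges_def)
    then show "b \<in> S" using ab(1) E[of "{a, b}"] by (auto simp: cut_def)
  qed (use st S in \<open>auto simp: delete_edges_def\<close>)
  then show False using st by blast
qed

text \<open>The hypotheses are the cases of 0, 1, 2 and 3 deleted vertices; from four on,
  \<open>2 * card U\<close> alone reaches 8.\<close>

lemma mixed_connected_if_edge_connected:
  fixes G :: "'v::finite graph"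
  assumes V: "verts G = UNIV" and conn: "edge_connected 8 G"
    "\<forall>u. edge_connected 6 (delete_verts G {u})"
    "\<forall>u v. edge_connected 4 (delete_verts G {u, v})"
    "\<forall>u v w. edge_connected 2 (delete_verts G {u, v, w})"
  shows "mixed_connected (edges G)"
  unfolding mixed_connected_def
proof (intro allI impI)
  fix U S :: "'v set" assume S: "S \<noteq> {}" "U \<inter> S = {}" "U \<union> S \<noteq> UNIV"
  consider "card U = 0" | "card U = 1" | "card U = 2" | "card U = 3" | "4 \<le> card U" by linarith
  then have "edge_connected (8 - 2 * card U) (delete_verts G U) \<or> 4 \<le> card U"
  proof cases
    case 1
    then have "delete_verts G U = G" by (simp add: delete_verts_def)
    then show ?thesis using conn(1) 1 by simp
  qed (use conn in \<open>auto simp: card_1_singleton_iff card_2_iff card_3_iff\<close>)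
  then show "8 \<le> card (cut (edges G) S (- (U \<union> S))) + 2 * card U"
  proof
    assume ec: "edge_connected (8 - 2 * card U) (delete_verts G U)"
    have "8 - 2 * card U \<le> card (cut (edges (delete_verts G U)) S (verts (delete_verts G U) - S))"
      by (rule edge_connected_cut[OF ec]) (use S V in \<open>auto simp: delete_verts_def\<close>)
    also have "\<dots> \<le> card (cut (edges G) S (- (U \<union> S)))"
      by (rule card_mono) (auto simp: cut_def delete_verts_def)
    finally show ?thesis by simp
  qed simp
qed

text \<open>Whitney's argument: given non-adjacent \<open>s\<close> and \<open>t\<close> on the two sides, delete an endpoint other than
  \<open>s\<close> and \<open>t\<close> of every edge of the cut.\<close>

lemma mixed_connected_if_vertex_connected:
  fixes G :: "'v::finite graph"
  assumes V: "verts G = UNIV" and conn: "vertex_connected 8 G"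
  shows "mixed_connected (edges G)"
  unfolding mixed_connected_def
proof (intro allI impI, rule ccontr)
  fix U S :: "'v set" assume S: "S \<noteq> {}" "U \<inter> S = {}" "U \<union> S \<noteq> UNIV"
  define R where "R = - (U \<union> S)"
  define C where "C = cut (edges G) S R"
  assume "\<not> 8 \<le> card (cut (edges G) S (- (U \<union> S))) + 2 * card U"
  then have few: "card C + card U < 8" by (simp add: C_def R_def)
  have R: "R \<noteq> {}" "S \<inter> R = {}" using S by (auto simp: R_def)
  show False
  proof (cases "\<forall>s\<in>S. \<forall>t\<in>R. {s, t} \<in> edges G")
    \<comment> \<open>If all pairs across are adjacent, the cut has at least
      \<open>card S * card R \<ge> card S + card R - 1\<close> edges; with at least nine vertices in
      total, \<open>card C + card U\<close> is at least 8.\<close>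
    case True
    have "inj_on (\<lambda>(s, t). {s, t}) (S \<times> R)" using R(2) by (auto simp: inj_on_def doubleton_eq_iff)
    then have "card S * card R = card ((\<lambda>(s, t). {s, t}) ` (S \<times> R))"
      by (simp add: card_image card_cartesian_product)
    also have "\<dots> \<le> card C" using True by (intro card_mono) (auto simp: C_def cut_def)
    finally have le: "card S * card R \<le> card C" .
    have "U \<union> S \<union> R = UNIV" "(U \<union> S) \<inter> R = {}" by (auto simp: R_def)
    then have "card U + card S + card R = CARD('v)"
      using card_Un_disjoint[of "U \<union> S" R] card_Un_disjoint[of U S] S(2) by simp
    moreover have "8 < CARD('v)" using conn V by (simp add: vertex_connected_def)
    moreover have "card S + card R \<le> card S * card R + 1"
    proof -
      obtain a b where "card S = Suc a" "card R = Suc b"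
        using S(1) R(1) by (metis card_gt_0_iff finite gr0_implies_Suc)
      then show ?thesis by simp
    qed
    ultimately show False using le few by linarith
  next
    case False
    then obtain s t where st: "s \<in> S" "t \<in> R" "{s, t} \<notin> edges G" by blast
    have "\<exists>a\<in>e. a \<noteq> s \<and> a \<noteq> t" if "e \<in> C" for e
    proof -
      obtain a b where "a \<in> S" "b \<in> R" "e = {a, b}" "e \<in> edges G"
        using \<open>e \<in> C\<close> by (auto simp: C_def cut_def)
      then show ?thesis using st R(2) by (cases "a = s") auto
    qed
    then obtain f where f: "\<And>e. e \<in> C \<Longrightarrow> f e \<in> e \<and> f e \<noteq> s \<and> f e \<noteq> t" by metis
    let ?W = "U \<union> f ` C"
    have "card ?W \<le> card U + card (f ` C)" by (rule card_Un_le)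
    also have "\<dots> \<le> card U + card C" by (simp add: card_image_le)
    finally have "card ?W < 8" using few by linarith
    then have c: "connected_graph (delete_verts G ?W)"
      using conn V by (simp add: vertex_connected_def)
    have "t \<in> S"
    proof (rule connected_graph_closed[OF c])
      fix a b assume a: "a \<in> S" and ab: "{a, b} \<in> edges (delete_verts G ?W)"
      then have e: "{a, b} \<in> edges G" "{a, b} \<inter> ?W = {}" by (simp_all add: delete_verts_def)
      have "{a, b} \<notin> C"
      proof
        assume "{a, b} \<in> C"
        then have "f {a, b} \<in> {a, b} \<inter> ?W" using f by blast
        then show False using e(2) by blast
      qed
      then have "b \<notin> R" using a e(1) by (auto simp: C_def cut_def)
      moreover have "b \<notin> U" using e(2) by auto
      ultimately show "b \<in> S" by (simp add: R_def)
    next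
      show "s \<in> verts (delete_verts G ?W)" "t \<in> verts (delete_verts G ?W)"
        using V st S(2) f by (auto simp: delete_verts_def R_def)
    qed (use st in auto)
    then show False using st(2) R(2) by blast
  qed
qed

theorem rigid_in_cylinder_if_mixed_connected:
  fixes E :: "'v::finite set set"
  assumes E: "\<And>e. e \<in> E \<Longrightarrow> card e = 2" and conn: "mixed_connected E" and two: "2 \<le> CARD('v)"
  shows "rigid_in TYPE(cylinder) E"
proof (rule packing_laman_and_tree[OF E conn two])
  fix H T assume HT: "H \<subseteq> E" "T \<subseteq> E" "H \<inter> T = {}"
    "count_sparse 2 3 H" "card H + 3 = 2 * CARD('v)" "count_sparse 1 1 T" "card T + 1 = CARD('v)"
  have "laman UNIV H" using HT E by (auto simp: laman_def)
  moreover have "tree UNIV T" using HT E by (auto simp: tree_def)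
  ultimately show ?thesis using E HT two by (intro cylinder_rigid_if_tree_and_laman[of E H T]) auto
qed

theorem corollary4p7:
  fixes G :: "'v::finite graph"
  assumes "simple_graph G" and "verts G = UNIV"
  shows "(card (verts G) \<ge> 5 \<and>
          edge_connected 8 G \<and>
          (\<forall>u\<in>verts G. edge_connected 6 (delete_verts G {u})) \<and>
          (\<forall>u\<in>verts G. \<forall>v\<in>verts G. edge_connected 4 (delete_verts G {u, v})) \<and>
          (\<forall>u\<in>verts G. \<forall>v\<in>verts G. \<forall>w\<in>verts G.
             edge_connected 2 (delete_verts G {u, v, w}))
            \<longrightarrow> rigid_in TYPE(cylinder) (edges G))
       \<and> (vertex_connected 8 G \<longrightarrow> rigid_in TYPE(cylinder) (edges G))"
proof (intro conjI impI)
  have E: "card e = 2" if "e \<in> edges G" for e using assms(1) that by (simp add: simple_graph_def)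
  {
    assume *: "card (verts G) \<ge> 5 \<and> edge_connected 8 G \<and>
          (\<forall>u\<in>verts G. edge_connected 6 (delete_verts G {u})) \<and>
          (\<forall>u\<in>verts G. \<forall>v\<in>verts G. edge_connected 4 (delete_verts G {u, v})) \<and>
          (\<forall>u\<in>verts G. \<forall>v\<in>verts G. \<forall>w\<in>verts G. edge_connected 2 (delete_verts G {u, v, w}))"
    then have "mixed_connected (edges G)"
      using assms(2) by (intro mixed_connected_if_edge_connected) auto
    moreover have "2 \<le> CARD('v)" using * assms(2) by simp
    ultimately show "rigid_in TYPE(cylinder) (edges G)"
      using E by (intro rigid_in_cylinder_if_mixed_connected)
  next
    assume *: "vertex_connected 8 G"
    then have "mixed_connected (edges G)" using assms(2) by (rule mixed_connected_if_vertex_connected[rotated])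
    moreover have "2 \<le> CARD('v)" using * assms(2) by (simp add: vertex_connected_def)
    ultimately show "rigid_in TYPE(cylinder) (edges G)"
      using E by (intro rigid_in_cylinder_if_mixed_connected)
  }
qed

end
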